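(* Let $p$ be a prime, $r \geq 1$, $q \geq 0$, and $A = C_p^{(r)} \oplus I_q$. Then: (1) if $r = 1$ and $p \neq 2$, then $A \notin GR$; (2) if $r = 2$ and $p \in \{3,5\}$, then $A \in GR^*(3)$; (3) in all other cases, $A \in GR(2)$.
   Context: A $k$-colored graph $G=(V,E)$ consists of a finite set $V$ and a function $E$ from the 2-element subsets of $V$ to $\{0,\ldots,k-1\}$. An automorphism of $G$ is a permutation of $V$ preserving $E$; $Aut(G)$ is the automorphism group as a permutation group on $V$. Permutation groups are considered up to permutation isomorphism. $GR(k)$ is the class of permutation groups $(A,V)$ with $A=Aut(G)$ for some $k$-colored graph $G$ on $V$; $GR=\bigcup_k GR(k)$; $GR^*(k)=GR(k)\setminus GR(k-1)$. $C_p$ denotes the regular action of $\mathbb{Z}_p$ on $p$ points. $I_q$ denotes the trivial group acting on $q$ points; $A\oplus I_0=A$. For $(A,V)$, the parallel product $A^{(r)}$ is $A$ acting on $V\times\{1,\ldots,r\}$ by $a((v,i))=(a(v),i)$. For permutation groups with disjoint domains, the direct sum $A\oplus B$ is the group of pairs $(a,b)$ acting on the union, with $a$ acting on the domain of $A$ and $b$ on that of $B$. *)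

theory Defs
  imports
    "HOL-Combinatorics.Permutations"
    "HOL-Library.Ramsey"
    "HOL-Computational_Algebra.Primes"
begin

text \<open>
  A permutation group is a pair of a set of permutations and its domain. As usual for
  \<^const>\<open>permutes\<close>, the permutations are total functions that are the identity off the domain,
  so that equality of sets of functions is equality of groups of permutations of the domain.
\<close>

type_synonym 'a perm_grp = "('a \<Rightarrow> 'a) set \<times> 'a set"

definition is_perm_group :: "'a perm_grp \<Rightarrow> bool" where
  "is_perm_group = (\<lambda>(A, V).
     (\<forall>a\<in>A. a permutes V) \<and> id \<in> A \<and> (\<forall>a\<in>A. \<forall>b\<in>A. a \<circ> b \<in> A) \<and> (\<forall>a\<in>A. inv a \<in> A))"

text \<open>
  The map on the groups is automatically a homomorphism, because permutations are determined by
  their action.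
\<close>

definition perm_iso :: "'a perm_grp \<Rightarrow> 'b perm_grp \<Rightarrow> bool" where
  "perm_iso = (\<lambda>(A, V) (B, W). \<exists>\<phi> \<psi>. bij_betw \<phi> V W \<and> bij_betw \<psi> A B \<and>
     (\<forall>a\<in>A. \<forall>v\<in>V. \<phi> (a v) = \<psi> a (\<phi> v)))"

text \<open>
  Only the values of the colouring on the 2-element subsets of the vertex set matter. Not every
  colour has to be used, so a k-coloured graph is also an l-coloured one for all larger l.
\<close>

definition colored_graph :: "nat \<Rightarrow> 'a set \<Rightarrow> ('a set \<Rightarrow> nat) \<Rightarrow> bool" where
  "colored_graph k V E \<longleftrightarrow> finite V \<and> E \<in> nsets V 2 \<rightarrow> {..<k}"

definition Aut :: "'a set \<Rightarrow> ('a set \<Rightarrow> nat) \<Rightarrow> ('a \<Rightarrow> 'a) set" where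
  "Aut V E = {f. f permutes V \<and> (\<forall>e\<in>nsets V 2. E (f ` e) = E e)}"

definition GR :: "nat \<Rightarrow> 'a perm_grp set" where
  "GR k = {(A, V). \<exists>E. colored_graph k V E \<and> A = Aut V E}"

definition GR_all :: "'a perm_grp set" where
  "GR_all = (\<Union>k. GR k)"

text \<open>Meant for positive \<open>k\<close> only, as \<open>k - 1\<close> is truncated subtraction.\<close>

definition GR_star :: "nat \<Rightarrow> 'a perm_grp set" where
  "GR_star k = GR k - GR (k - 1)"

definition cyclic_regular :: "nat \<Rightarrow> nat perm_grp" where
  "cyclic_regular p = ({\<lambda>x. if x < p then (x + t) mod p else x | t. t < p}, {..<p})"

definition trivial_grp :: "nat \<Rightarrow> nat perm_grp" where
  "trivial_grp q = ({id}, {..<q})"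

definition parallel_product :: "'a perm_grp \<Rightarrow> nat \<Rightarrow> ('a \<times> nat) perm_grp" where
  "parallel_product = (\<lambda>(A, V) r.
     ((\<lambda>a (v, i). if i \<in> {1..r} then (a v, i) else (v, i)) ` A, V \<times> {1..r}))"

text \<open>The sum type makes the domains disjoint.\<close>

definition direct_sum :: "'a perm_grp \<Rightarrow> 'b perm_grp \<Rightarrow> ('a + 'b) perm_grp" where
  "direct_sum = (\<lambda>(A, V) (B, W). ({map_sum a b | a b. a \<in> A \<and> b \<in> B}, V <+> W))"

text \<open>The convention that adding the trivial group on no points changes nothing.\<close>

lemma direct_sum_trivial_0: "perm_iso A (direct_sum A (trivial_grp 0))"
proof -
  obtain S V where A: "A = (S, V)" by (cases A)
  have "bij_betw Inl V (V <+> ({} :: nat set))"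
    by (auto simp: bij_betw_def)
  moreover have "bij_betw (\<lambda>a. map_sum a (id :: nat \<Rightarrow> nat)) S {map_sum a b | a b. a \<in> S \<and> b \<in> {id}}"
  proof -
    have "inj_on (\<lambda>a. map_sum a (id :: nat \<Rightarrow> nat)) S"
      by (rule inj_onI, rule ext) (metis map_sum.simps(1) sum.inject(1))
    then show ?thesis by (auto simp: bij_betw_def)
  qed
  ultimately show ?thesis
    unfolding A perm_iso_def direct_sum_def trivial_grp_def by fastforce
qed

lemma is_perm_group_Aut: "is_perm_group (Aut V E, V)"
proof -
  have im: "f ` e \<in> nsets V 2" if "f permutes V" "e \<in> nsets V 2" for f and e :: "'a set"
    using that(2) permutes_in_image[OF that(1)] card_image[OF permutes_inj_on[OF that(1)], of e]
    by (auto simp: nsets_def)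
  have "E (inv f ` e) = E e" if f: "f \<in> Aut V E" and e: "e \<in> nsets V 2" for f e
  proof -
    have p: "f permutes V" using f by (simp add: Aut_def)
    have "f ` (inv f ` e) = e"
      by (simp add: image_comp permutes_inv_o[OF p])
    moreover have "E (f ` (inv f ` e)) = E (inv f ` e)"
      using f im[OF permutes_inv[OF p] e] by (simp add: Aut_def)
    ultimately show ?thesis by simp
  qed
  moreover have "E ((f \<circ> g) ` e) = E e"
    if "f \<in> Aut V E" "g \<in> Aut V E" "e \<in> nsets V 2" for f g e
    using that im[of g e] by (simp add: Aut_def image_comp[symmetric] del: o_apply)
  ultimately show ?thesis
    by (auto simp: is_perm_group_def Aut_def permutes_id permutes_inv permutes_compose)
qed

lemma is_perm_group_cyclic_regular:
  assumes "p > 0" shows "is_perm_group (cyclic_regular p)"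
proof -
  define s where "s t = (\<lambda>x. if x < p then (x + t) mod p else x)" for t
  have comp: "s t \<circ> s u = s ((t + u) mod p)" for t u
    using assms by (auto simp: s_def fun_eq_iff mod_simps add_ac)
  have z: "s 0 = id" by (auto simp: s_def fun_eq_iff)
  have inv: "s ((p - t) mod p) \<circ> s t = id" "s t \<circ> s ((p - t) mod p) = id" if "t < p" for t
    using that assms by (simp_all add: comp mod_simps z)
  have perm: "s t permutes {..<p}" if "t < p" for t
    unfolding permutes_def using o_bij[OF inv[OF that]] by (simp add: bij_iff s_def)
  have eq: "cyclic_regular p = (s ` {..<p}, {..<p})"
    by (auto simp: cyclic_regular_def s_def)
  have "inv (s t) \<in> s ` {..<p}" if "t < p" for t
    using inv_unique_comp[OF inv(2,1)[OF that]] assms by auto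
  moreover have "id \<in> s ` {..<p}" using z assms by (metis imageI lessThan_iff)
  ultimately show ?thesis
    using assms by (auto simp: eq is_perm_group_def perm comp)
qed

lemma is_perm_groupI:
  assumes "id \<in> A" and "\<And>a b. a \<in> A \<Longrightarrow> b \<in> A \<Longrightarrow> a \<circ> b \<in> A"
    and inv: "\<And>a. a \<in> A \<Longrightarrow> \<exists>b\<in>A. a \<circ> b = id \<and> b \<circ> a = id"
    and off: "\<And>a v. a \<in> A \<Longrightarrow> v \<notin> V \<Longrightarrow> a v = v"
  shows "is_perm_group (A, V)"
proof -
  have "a permutes V \<and> inv a \<in> A" if a: "a \<in> A" for a
  proof -
    obtain b where b: "b \<in> A" "a \<circ> b = id" "b \<circ> a = id"
      using inv[OF a] by blast
    then show ?thesis
      unfolding permutes_def using off[OF a] o_bij[OF b(3,2)] inv_unique_comp[OF b(2,3)]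
      by (simp add: bij_iff)
  qed
  with assms show ?thesis by (auto simp: is_perm_group_def)
qed

lemma is_perm_groupD:
  assumes "is_perm_group (A, V)"
  shows "id \<in> A" "\<And>a b. a \<in> A \<Longrightarrow> b \<in> A \<Longrightarrow> a \<circ> b \<in> A"
    "\<And>a. a \<in> A \<Longrightarrow> \<exists>b\<in>A. a \<circ> b = id \<and> b \<circ> a = id"
    "\<And>a v. a \<in> A \<Longrightarrow> v \<notin> V \<Longrightarrow> a v = v"
  using assms permutes_inv_o by (auto simp: is_perm_group_def permutes_not_in) blast

lemma is_perm_group_trivial_grp: "is_perm_group (trivial_grp q)"
  unfolding trivial_grp_def by (rule is_perm_groupI) auto

lemma is_perm_group_parallel_product:
  assumes "is_perm_group A" shows "is_perm_group (parallel_product A r)"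
proof -
  obtain S V where A: "A = (S, V)" by (cases A)
  note g = is_perm_groupD[OF assms[unfolded A]]
  define h :: "('a \<Rightarrow> 'a) \<Rightarrow> 'a \<times> nat \<Rightarrow> 'a \<times> nat"
    where "h a = (\<lambda>(v, i). if i \<in> {1..r} then (a v, i) else (v, i))" for a
  have hc: "h a \<circ> h b = h (a \<circ> b)" for a b by (auto simp: h_def fun_eq_iff)
  have hi: "h id = id" by (auto simp: h_def fun_eq_iff)
  have "is_perm_group (h ` S, V \<times> {1..r})"
  proof (rule is_perm_groupI)
    show "id \<in> h ` S" using g(1) hi by (metis imageI)
    show "a \<circ> b \<in> h ` S" if "a \<in> h ` S" "b \<in> h ` S" for a b
      using that g(2) hc by auto
    show "\<exists>b\<in>h ` S. a \<circ> b = id \<and> b \<circ> a = id" if a: "a \<in> h ` S" for a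
    proof -
      obtain c where c: "c \<in> S" "a = h c" using a by blast
      obtain b where b: "b \<in> S" "c \<circ> b = id" "b \<circ> c = id" using g(3)[OF c(1)] by blast
      show ?thesis by (rule bexI[of _ "h b"]) (use b c hc hi in auto)
    qed
    show "a x = x" if "a \<in> h ` S" "x \<notin> V \<times> {1..r}" for a x
      using that g(4) by (cases x) (auto simp: h_def)
  qed
  then show ?thesis by (simp add: A parallel_product_def h_def)
qed

lemma is_perm_group_direct_sum:
  assumes "is_perm_group A" and "is_perm_group B" shows "is_perm_group (direct_sum A B)"
proof -
  obtain S V where A: "A = (S, V)" by (cases A)
  obtain T W where B: "B = (T, W)" by (cases B)
  note g = is_perm_groupD[OF assms(1)[unfolded A]]
  note h = is_perm_groupD[OF assms(2)[unfolded B]]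
  show ?thesis unfolding A B direct_sum_def prod.case
  proof (rule is_perm_groupI)
    show "id \<in> {map_sum a b |a b. a \<in> S \<and> b \<in> T}"
      using g(1) h(1) sum.map_id0 by (smt (verit) mem_Collect_eq)
    show "x \<circ> y \<in> {map_sum a b |a b. a \<in> S \<and> b \<in> T}"
      if "x \<in> {map_sum a b |a b. a \<in> S \<and> b \<in> T}" "y \<in> {map_sum a b |a b. a \<in> S \<and> b \<in> T}" for x y
    proof -
      from that obtain a b c d where *: "a \<in> S" "b \<in> T" "c \<in> S" "d \<in> T"
          "x = map_sum a b" "y = map_sum c d"
        by auto
      have "x \<circ> y = map_sum (a \<circ> c) (b \<circ> d)" by (simp add: * map_sum.comp)
      then show ?thesis using * g(2) h(2) by blast
    qed
    show "\<exists>y\<in>{map_sum a b |a b. a \<in> S \<and> b \<in> T}. x \<circ> y = id \<and> y \<circ> x = id"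
      if "x \<in> {map_sum a b |a b. a \<in> S \<and> b \<in> T}" for x
    proof -
      from that obtain a b where *: "a \<in> S" "b \<in> T" "x = map_sum a b" by auto
      obtain c where c: "c \<in> S" "a \<circ> c = id" "c \<circ> a = id" using g(3)[OF *(1)] by blast
      obtain d where d: "d \<in> T" "b \<circ> d = id" "d \<circ> b = id" using h(3)[OF *(2)] by blast
      have "x \<circ> map_sum c d = id" "map_sum c d \<circ> x = id"
        using c d by (simp_all add: * map_sum.comp sum.map_id0)
      then show ?thesis using c d by blast
    qed
    show "x v = v" if "x \<in> {map_sum a b |a b. a \<in> S \<and> b \<in> T}" "v \<notin> V <+> W" for x v
      using that by (cases v) (auto intro: ccontr dest: g(4) h(4))
  qed
qed

end

theory Submission
  imports Defs "HOL-Number_Theory.Cong"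
begin

text \<open>
  Adding a fixed point keeps a group in GR(k) for k \<open>\<ge>\<close> 2: join it to everything in a colour in which
  no old vertex sees everything. So the positive results reduce to q = 0. There, a graph for r orbits
  extends to one for r + 1 orbits by a pendant perfect matching at the last orbit, which leaves the
  starting graphs: one edge for p = 2; for p \<open>\<ge>\<close> 7 and two orbits, a cycle on the first joined to the
  second by the differences 0, 1, 3, whose set of gaps has no reflection symmetry; for p \<open>\<ge>\<close> 3 and
  three orbits, a complete first orbit and the differences 0 (first to second, second to third) and
  0, 1 (first to third). With three colours on two orbits, one colours the differences 0, 1 and the
  rest differently.

  The negative results come from reflections. On each orbit an invariant colouring is symmetric under
  all reflections, and edges to fixed points do not matter, so one orbit never suffices for odd p. For
  two orbits and p = 3, 5, every subset of the residues mod p is symmetric under some reflection, so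
  two colours do not suffice either.
\<close>

section \<open>Edgewise criteria and invariance under permutation isomorphism\<close>

lemma Aut_iff:
  "f \<in> Aut V E \<longleftrightarrow> f permutes V \<and> (\<forall>u\<in>V. \<forall>v\<in>V. u \<noteq> v \<longrightarrow> E {f u, f v} = E {u, v})"
  by (fastforce simp: Aut_def nsets_2_eq)

lemma colored_graph_iff:
  "colored_graph k V E \<longleftrightarrow> finite V \<and> (\<forall>u\<in>V. \<forall>v\<in>V. u \<noteq> v \<longrightarrow> E {u, v} < k)"
  by (fastforce simp: colored_graph_def nsets_2_eq)

lemma GR_iff: "(A, V) \<in> GR k \<longleftrightarrow> (\<exists>E. colored_graph k V E \<and> A = Aut V E)"
  by (simp add: GR_def)

text \<open>Both maps are inverted. That \<open>A\<close> consists of permutations of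
  \<open>V\<close> keeps \<open>a v\<close> inside \<open>V\<close>, where
  \<open>inv_into V \<phi>\<close> undoes \<open>\<phi>\<close>.\<close>

lemma perm_iso_sym:
  assumes "is_perm_group (A, V)" "perm_iso (A, V) (B, W)"
  shows "perm_iso (B, W) (A, V)"
proof -
  obtain \<phi> \<psi> where \<phi>: "bij_betw \<phi> V W" and \<psi>: "bij_betw \<psi> A B"
    and eq: "\<And>a v. a \<in> A \<Longrightarrow> v \<in> V \<Longrightarrow> \<phi> (a v) = \<psi> a (\<phi> v)"
    using assms(2) by (auto simp: perm_iso_def)
  have "inv_into V \<phi> (b w) = inv_into A \<psi> b (inv_into V \<phi> w)" if bw: "b \<in> B" "w \<in> W" for b w
  proof -
    obtain a where a: "a \<in> A" "b = \<psi> a" using bw \<psi> by (auto simp: bij_betw_def)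
    obtain v where v: "v \<in> V" "w = \<phi> v" using bw \<phi> by (auto simp: bij_betw_def)
    have "a v \<in> V" using assms(1) a v by (auto simp: is_perm_group_def permutes_in_image)
    moreover have "b w = \<phi> (a v)" using eq a v by simp
    ultimately show ?thesis
      using a v \<phi> \<psi> by (simp add: bij_betw_inv_into_left)
  qed
  then show ?thesis
    using bij_betw_inv_into[OF \<phi>] bij_betw_inv_into[OF \<psi>] unfolding perm_iso_def by blast
qed

text \<open>The colouring is pulled back along \<open>\<phi>\<close>. An automorphism
  \<open>f\<close> of the pullback, conjugated by \<open>\<phi>\<close> and made the identity off
  \<open>W\<close>, is an automorphism \<open>g\<close> in \<open>B\<close>. So \<open>g\<close> is
  \<open>\<psi> a\<close> for some \<open>a\<close>, and injectivity of \<open>\<phi>\<close> gives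
  \<open>a = f\<close>.\<close>

lemma GR_perm_iso:
  assumes A: "is_perm_group (A, V)" and iso: "perm_iso (A, V) (B, W)" and B: "(B, W) \<in> GR k"
  shows "(A, V) \<in> GR k"
proof -
  obtain E where E: "colored_graph k W E" and BE: "B = Aut W E"
    using B by (auto simp: GR_iff)
  obtain \<phi> \<psi> where \<phi>: "bij_betw \<phi> V W" and \<psi>: "bij_betw \<psi> A B"
    and eq: "\<And>a v. a \<in> A \<Longrightarrow> v \<in> V \<Longrightarrow> \<phi> (a v) = \<psi> a (\<phi> v)"
    using iso by (auto simp: perm_iso_def)
  have inj: "\<phi> u = \<phi> v \<longleftrightarrow> u = v" if "u \<in> V" "v \<in> V" for u v
    using \<phi> that by (auto simp: bij_betw_def inj_on_def)
  have mem: "\<phi> u \<in> W" if "u \<in> V" for u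
    using \<phi> that by (auto simp: bij_betw_def)
  define F where "F = (\<lambda>e. E (\<phi> ` e))"
  have perm: "a permutes V" if "a \<in> A" for a
    using A that by (auto simp: is_perm_group_def)
  have "colored_graph k V F"
    using E inj mem bij_betw_finite[OF \<phi>] by (auto simp: colored_graph_iff F_def)
  moreover have "A = Aut V F"
  proof (intro subset_antisym subsetI)
    fix a assume a: "a \<in> A"
    have "\<psi> a \<in> Aut W E" using a \<psi> BE by (auto simp: bij_betw_def)
    then show "a \<in> Aut V F"
      using perm[OF a] eq[OF a] inj mem by (auto simp: Aut_iff F_def)
  next
    fix f assume f: "f \<in> Aut V F"
    have fp: "f permutes V" using f by (simp add: Aut_iff)
    define \<rho> where "\<rho> = inv_into V \<phi>"
    define g where "g = (\<lambda>w. if w \<in> W then \<phi> (f (\<rho> w)) else w)"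
    have \<rho>: "bij_betw \<rho> W V" using \<phi> by (simp add: \<rho>_def bij_betw_inv_into)
    have \<rho>\<phi>: "\<rho> (\<phi> v) = v" if "v \<in> V" for v
      using that \<phi> by (simp add: \<rho>_def bij_betw_inv_into_left)
    have g\<phi>: "g (\<phi> v) = \<phi> (f v)" if "v \<in> V" for v
      using that mem \<rho>\<phi> by (simp add: g_def)
    have "bij_betw (\<phi> \<circ> f \<circ> \<rho>) W W"
      using \<rho> \<phi> permutes_imp_bij[OF fp] by (auto intro: bij_betw_trans)
    then have "bij_betw g W W"
      by (rule bij_betw_cong[THEN iffD1, rotated]) (simp add: g_def)
    then have "g permutes W" by (rule bij_imp_permutes) (simp add: g_def)
    moreover have "E {g u, g v} = E {u, v}" if uv: "u \<in> W" "v \<in> W" "u \<noteq> v" for u v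
    proof -
      obtain u' v' where "u = \<phi> u'" "v = \<phi> v'" "u' \<in> V" "v' \<in> V"
        using uv \<phi> by (auto simp: bij_betw_def)
      then show ?thesis using g\<phi> f uv by (auto simp: Aut_iff F_def)
    qed
    ultimately have "g \<in> B" by (auto simp: BE Aut_iff)
    then obtain a where a: "a \<in> A" "g = \<psi> a" using \<psi> by (auto simp: bij_betw_def)
    have "a v = f v" for v
    proof (cases "v \<in> V")
      case True
      then have "\<phi> (a v) = \<phi> (f v)" using eq a g\<phi> by simp
      then show ?thesis
        using inj True perm[OF a(1)] fp by (simp add: permutes_in_image)
    next
      case False
      then show ?thesis using perm[OF a(1)] fp by (simp add: permutes_not_in)
    qed
    then show "f \<in> A" using a by (metis ext)
  qed
  ultimately show ?thesis by (auto simp: GR_iff)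
qed

section \<open>Adding fixed points\<close>

text \<open>\<open>w\<close> is joined to all of \<open>V\<close> in a colour \<open>c\<close> that
  no vertex of \<open>V\<close> has on all its edges. Then only \<open>w\<close> sees nothing but
  \<open>c\<close>, so every automorphism fixes it. Two distinct old vertices are required because a
  single one could be exchanged with \<open>w\<close>.\<close>

lemma GR_insert:
  assumes G: "(A, V) \<in> GR k" and k: "k \<ge> 2" and w: "w \<notin> V" and V: "u0 \<in> V" "u1 \<in> V" "u0 \<noteq> u1"
  shows "(A, insert w V) \<in> GR k"
proof -
  obtain E where E: "colored_graph k V E" and A: "A = Aut V E"
    using G by (auto simp: GR_iff)
  \<comment> \<open>If neither 0 nor 1 qualified, some \<open>a\<close> would see only 0 and some
    \<open>b\<close> only 1. The edge between them, or any edge at \<open>a = b\<close>, would then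
    have both colours.\<close>
  have "\<exists>c<2. \<forall>v\<in>V. \<exists>u\<in>V. u \<noteq> v \<and> E {u, v} \<noteq> c"
  proof (rule ccontr)
    assume "\<not> ?thesis"
    then have *: "\<forall>c<2. \<exists>v\<in>V. \<forall>u\<in>V. u \<noteq> v \<longrightarrow> E {u, v} = c" by blast
    obtain a where a: "a \<in> V" "\<And>u. u \<in> V \<Longrightarrow> u \<noteq> a \<Longrightarrow> E {u, a} = 0"
      using *[rule_format, of 0] by auto
    obtain b where b: "b \<in> V" "\<And>u. u \<in> V \<Longrightarrow> u \<noteq> b \<Longrightarrow> E {u, b} = 1"
      using *[rule_format, of 1] by auto
    show False
    proof (cases "a = b")
      case True
      then show False using a(2)[of u0] a(2)[of u1] b(2)[of u0] b(2)[of u1] V by auto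
    next
      case False
      then show False using a(2)[of b] b(2)[of a] a(1) b(1) by (auto simp: insert_commute)
    qed
  qed
  then obtain c where c: "c < 2" "\<And>v. v \<in> V \<Longrightarrow> \<exists>u\<in>V. u \<noteq> v \<and> E {u, v} \<noteq> c" by blast
  define F where "F = (\<lambda>e. if w \<in> e then c else E e)"
  have FE: "F {u, v} = E {u, v}" if "u \<in> V" "v \<in> V" for u v
    using that w by (auto simp: F_def)
  have Fw: "F {u, w} = c" "F {w, u} = c" for u by (auto simp: F_def)
  have "colored_graph k (insert w V) F"
    using E c k FE Fw by (auto simp: colored_graph_iff)
  moreover have "Aut (insert w V) F = Aut V E"
  proof (intro subset_antisym subsetI)
    fix f assume f: "f \<in> Aut V E"
    have fp: "f permutes V" using f by (simp add: Aut_iff)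
    have "f w = w" using fp w by (simp add: permutes_not_in)
    then show "f \<in> Aut (insert w V) F"
      using f fp permutes_subset[OF fp, of "insert w V"] FE Fw
      by (auto simp: Aut_iff permutes_in_image)
  next
    fix f assume f: "f \<in> Aut (insert w V) F"
    have fp: "f permutes insert w V" using f by (simp add: Aut_iff)
    \<comment> \<open>Otherwise the vertex \<open>f w\<close> of \<open>V\<close> would inherit from
      \<open>w\<close> that all its edges have colour \<open>c\<close>.\<close>
    have fw: "f w = w"
    proof (rule ccontr)
      assume n: "f w \<noteq> w"
      then have "f w \<in> V" using permutes_in_image[OF fp, of w] by simp
      then obtain u where u: "u \<in> V" "u \<noteq> f w" "E {u, f w} \<noteq> c" using c(2) by blast
      obtain u' where u': "u = f u'" "u' \<in> insert w V"
        using permutes_image[OF fp] u(1) by blast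
      have "F {f u', f w} = F {u', w}"
        using f u u' by (auto simp: Aut_iff)
      then show False using u u' FE[OF u(1) \<open>f w \<in> V\<close>] Fw by auto
    qed
    have fV: "f permutes V"
      by (rule permutes_superset[OF fp]) (use fw in auto)
    then show "f \<in> Aut V E"
      using f FE by (auto simp: Aut_iff permutes_in_image)
  qed
  ultimately show ?thesis using A by (auto simp: GR_iff)
qed

text \<open>Elements of the sum are total functions that are the identity on the right summand, so
  the set of functions does not depend on \<open>q\<close> and only the domain grows.\<close>

lemma direct_sum_trivial_Suc:
  "direct_sum (A, V) (trivial_grp (Suc q)) =
    (fst (direct_sum (A, V) (trivial_grp q)), insert (Inr q) (snd (direct_sum (A, V) (trivial_grp q))))"
  by (auto simp: direct_sum_def trivial_grp_def less_Suc_eq)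

lemma GR_direct_sum_trivial:
  assumes A: "is_perm_group (A, V)" and G: "(A, V) \<in> GR k" and k: "k \<ge> 2"
    and V: "u0 \<in> V" "u1 \<in> V" "u0 \<noteq> u1"
  shows "direct_sum (A, V) (trivial_grp q) \<in> GR k"
proof (induction q)
  case 0
  \<comment> \<open>Even without new points the sum changes the vertex type, so this case goes
    through the isomorphism \<open>direct_sum_trivial_0\<close>.\<close>
  obtain B W where B: "direct_sum (A, V) (trivial_grp 0) = (B, W)" by fastforce
  have "is_perm_group (B, W)"
    using is_perm_group_direct_sum[OF A is_perm_group_trivial_grp, of 0] B by simp
  then show ?case
    using GR_perm_iso[OF _ perm_iso_sym[OF A] G] direct_sum_trivial_0[of "(A, V)"] B by metis
next
  case (Suc q)
  then show ?case
    unfolding direct_sum_trivial_Suc using V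
    by (intro GR_insert[OF _ k, of _ _ _ "Inl u0" "Inl u1"]) (auto simp: direct_sum_def trivial_grp_def)
qed

section \<open>Colour degrees as invariants\<close>

definition nbhd :: "'a set \<Rightarrow> ('a set \<Rightarrow> nat) \<Rightarrow> nat \<Rightarrow> 'a \<Rightarrow> 'a set" where
  "nbhd V E c v = {u \<in> V. u \<noteq> v \<and> E {u, v} = c}"

text \<open>An automorphism carries the neighbours in colour \<open>c\<close> of a vertex onto those
  of its image. These degrees later tell the layers apart.\<close>

lemma card_nbhd_Aut:
  assumes f: "f \<in> Aut V E" and v: "v \<in> V"
  shows "card (nbhd V E c (f v)) = card (nbhd V E c v)"
proof -
  have fp: "f permutes V" using f by (simp add: Aut_iff)
  have "nbhd V E c (f v) = f ` nbhd V E c v"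
  proof (intro subset_antisym subsetI)
    fix u assume u: "u \<in> nbhd V E c (f v)"
    then obtain u' where u': "u = f u'" "u' \<in> V"
      using permutes_image[OF fp] by (auto simp: nbhd_def)
    moreover have "u' \<noteq> v" using u u' by (auto simp: nbhd_def)
    moreover from this have "E {u', v} = c" using u f v u' by (simp add: nbhd_def Aut_iff)
    ultimately have "u' \<in> nbhd V E c v" by (simp add: nbhd_def)
    then show "u \<in> f ` nbhd V E c v" using u' by simp
  next
    fix u assume "u \<in> f ` nbhd V E c v"
    then show "u \<in> nbhd V E c (f v)"
      using f v fp permutes_inj[OF fp] by (auto simp: nbhd_def Aut_iff permutes_in_image inj_def)
  qed
  then show ?thesis using permutes_inj_on[OF fp] by (simp add: card_image)
qed

section \<open>Layers, rotations and a rigidity criterion\<close>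

definition layers :: "nat \<Rightarrow> nat \<Rightarrow> (nat \<times> nat) set" where
  "layers p r = {..<p} \<times> {1..r}"

definition rot :: "nat \<Rightarrow> nat \<Rightarrow> nat \<Rightarrow> nat \<times> nat \<Rightarrow> nat \<times> nat" where
  "rot p r t = (\<lambda>(x, i). if (x, i) \<in> layers p r then ((x + t) mod p, i) else (x, i))"

lemma mem_layers [simp]: "(x, i) \<in> layers p r \<longleftrightarrow> x < p \<and> 1 \<le> i \<and> i \<le> r"
  by (simp add: layers_def)

lemma finite_layers [simp]: "finite (layers p r)"
  by (simp add: layers_def)

lemma rot_simp [simp]: "x < p \<Longrightarrow> 1 \<le> i \<Longrightarrow> i \<le> r \<Longrightarrow> rot p r t (x, i) = ((x + t) mod p, i)"
  by (simp add: rot_def)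

lemma parallel_product_cyclic_eq:
  "parallel_product (cyclic_regular p) r = (rot p r ` {..<p}, layers p r)"
proof -
  define s where "s t = (\<lambda>x. if x < p then (x + t) mod p else x)" for t
  have c: "cyclic_regular p = (s ` {..<p}, {..<p})"
    by (auto simp: cyclic_regular_def s_def)
  have "(\<lambda>(v, i). if i \<in> {1..r} then (s t v, i) else (v, i)) = rot p r t" for t
    by (auto simp: rot_def s_def fun_eq_iff)
  then show ?thesis
    by (simp add: c parallel_product_def image_image layers_def)
qed

lemma rot_permutes:
  assumes "t < p" shows "rot p r t permutes layers p r"
proof -
  have "is_perm_group (parallel_product (cyclic_regular p) r)"
    using assms by (intro is_perm_group_parallel_product is_perm_group_cyclic_regular) auto
  then show ?thesis
    using assms by (auto simp: parallel_product_cyclic_eq is_perm_group_def)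
qed

text \<open>Off the layers an automorphism and a rotation are both the identity, so agreement with
  one shift on all layers identifies them. The shift in \<open>rigid\<close> is unbounded, as it is
  reduced modulo \<open>p\<close> afterwards.\<close>

lemma rot_image_eq_Aut:
  assumes p: "p > 0"
    and inv: "\<And>x i y j t. \<lbrakk>x < p; y < p; i \<in> {1..r}; j \<in> {1..r}; t < p; (x, i) \<noteq> (y, j)\<rbrakk> \<Longrightarrow>
      E {((x + t) mod p, i), ((y + t) mod p, j)} = E {(x, i), (y, j)}"
    and rigid: "\<And>f. f \<in> Aut (layers p r) E \<Longrightarrow>
      \<exists>t. \<forall>x<p. \<forall>i\<in>{1..r}. f (x, i) = ((x + t) mod p, i)"
  shows "rot p r ` {..<p} = Aut (layers p r) E"
proof (intro subset_antisym subsetI)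
  fix f assume "f \<in> rot p r ` {..<p}"
  then obtain t where t: "t < p" "f = rot p r t" by auto
  have "E {f u, f v} = E {u, v}" if "u \<in> layers p r" "v \<in> layers p r" "u \<noteq> v" for u v
    using inv[of "fst u" "fst v" "snd u" "snd v" t] that t by (cases u; cases v) simp
  then show "f \<in> Aut (layers p r) E"
    using rot_permutes t by (simp add: Aut_iff)
next
  fix f assume f: "f \<in> Aut (layers p r) E"
  then obtain t where t: "\<And>x i. x < p \<Longrightarrow> i \<in> {1..r} \<Longrightarrow> f (x, i) = ((x + t) mod p, i)"
    using rigid by blast
  have fp: "f permutes layers p r" using f by (simp add: Aut_iff)
  have "f v = rot p r (t mod p) v" for v
    using t permutes_not_in[OF fp, of v] by (cases v) (auto simp: rot_def mod_simps)
  then show "f \<in> rot p r ` {..<p}" using p by (metis ext imageI lessThan_iff mod_less_divisor)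
qed

text \<open>The shift \<open>t\<close> cancels from the congruence. Adjacency given by differences
  thus becomes rotation invariant by mere rewriting.\<close>

lemma rot_rel_iff:
  fixes x y t s p :: nat
  assumes "x < p" "y < p"
  shows "(y + t) mod p = ((x + t) mod p + s) mod p \<longleftrightarrow> y = (x + s) mod p"
proof -
  have "(y + t) mod p = ((x + t) mod p + s) mod p \<longleftrightarrow> [y + t = (x + s) + t] (mod p)"
    by (simp add: cong_def mod_simps ac_simps)
  also have "\<dots> \<longleftrightarrow> [y = x + s] (mod p)" by (rule cong_add_rcancel_nat)
  finally show ?thesis using assms by (simp add: cong_def)
qed

lemma rot_eq_iff:
  fixes x y t p :: nat
  assumes "x < p" "y < p"
  shows "(y + t) mod p = (x + t) mod p \<longleftrightarrow> y = x"
  using rot_rel_iff[OF assms, of t 0] assms by (simp add: mod_simps)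

text \<open>Commuting with the generator of the cycle determines a map from its value at 0. This
  ends every rigidity argument below.\<close>

lemma rotation_from_step:
  fixes \<sigma> :: "nat \<Rightarrow> nat"
  assumes p: "p > 0" and b: "\<sigma> 0 < p" and s: "\<And>x. x < p \<Longrightarrow> \<sigma> ((x + 1) mod p) = (\<sigma> x + 1) mod p"
  shows "x < p \<Longrightarrow> \<sigma> x = (x + \<sigma> 0) mod p"
proof (induction x)
  case 0
  then show ?case using b by simp
next
  case (Suc x)
  then have "\<sigma> (Suc x) = (\<sigma> x + 1) mod p" using s[of x] by simp
  also have "\<dots> = (Suc x + \<sigma> 0) mod p" using Suc by (simp add: mod_simps)
  finally show ?case .
qed

text \<open>Unordered pairs, so that the relations below can list each edge in one direction only.
  Loops merely add singletons, whose colour does not matter.\<close>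

definition edges_of :: "('a \<Rightarrow> 'a \<Rightarrow> bool) \<Rightarrow> 'a set set" where
  "edges_of R = {{u, v} | u v. R u v}"

lemma mem_edges_of [simp]: "{u, v} \<in> edges_of R \<longleftrightarrow> R u v \<or> R v u"
  by (auto simp: edges_of_def doubleton_eq_iff)

text \<open>Colour degrees are invariant. If they determine the layer, \<open>f\<close> keeps each
  layer and splits into one injection of the residues per layer.\<close>

lemma layer_preserving:
  assumes f: "f \<in> Aut (layers p r) E"
    and layer: "\<forall>x<p. \<forall>y<p. \<forall>i\<in>{1..r}. \<forall>j\<in>{1..r}.
      card (nbhd (layers p r) E c (x, i)) = card (nbhd (layers p r) E c (y, j)) \<longrightarrow> i = j"
  shows "\<exists>\<sigma>. \<forall>i\<in>{1..r}. inj_on (\<sigma> i) {..<p} \<and> (\<forall>x<p. f (x, i) = (\<sigma> i x, i) \<and> \<sigma> i x < p)"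
proof -
  have fp: "f permutes layers p r" using f by (simp add: Aut_iff)
  have *: "\<exists>y<p. f (x, i) = (y, i)" if x: "x < p" "i \<in> {1..r}" for x i
  proof -
    obtain y j where y: "f (x, i) = (y, j)" by fastforce
    have m: "(y, j) \<in> layers p r" using permutes_in_image[OF fp, of "(x, i)"] x y by simp
    have "card (nbhd (layers p r) E c (y, j)) = card (nbhd (layers p r) E c (x, i))"
      using card_nbhd_Aut[OF f, of "(x, i)" c] x y by simp
    then have "j = i" using layer[rule_format, of y x j i] m x by auto
    then show ?thesis using y m by auto
  qed
  define \<sigma> where "\<sigma> i x = fst (f (x, i))" for i x
  have 1: "f (x, i) = (\<sigma> i x, i)" "\<sigma> i x < p" if "x < p" "i \<in> {1..r}" for x i
    using *[OF that] by (auto simp: \<sigma>_def)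
  moreover have "inj_on (\<sigma> i) {..<p}" if i: "i \<in> {1..r}" for i
  proof (rule inj_onI)
    fix x y assume "x \<in> {..<p}" "y \<in> {..<p}" "\<sigma> i x = \<sigma> i y"
    then have "f (x, i) = f (y, i)" using 1(1) i by simp
    then show "x = y" using permutes_inj[OF fp] by (auto dest: injD)
  qed
  ultimately show ?thesis by blast
qed

lemma mod_predecessor:
  fixes x p :: nat
  assumes "x < p" obtains z where "z < p" "x = (z + s) mod p"
proof
  \<comment> \<open>The witness is \<open>x - s\<close> modulo \<open>p\<close>, written so that the
    truncated subtraction is exact.\<close>
  show "(x + (p - s mod p)) mod p < p" using assms by simp
  have "((x + (p - s mod p)) mod p + s) mod p = (x + (p - s mod p) + s mod p) mod p"
    by (simp add: mod_simps)
  also have "x + (p - s mod p) + s mod p = x + p"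
    using mod_less_divisor[of p s] assms by linarith
  finally show "x = ((x + (p - s mod p)) mod p + s) mod p"
    using assms by simp
qed

lemma mod_add_cancel:
  fixes x y s p :: nat
  assumes "x < p" "y < p"
  shows "(x + s) mod p = (y + s) mod p \<longleftrightarrow> x = y"
  using rot_eq_iff[of y p x s] assms by auto

lemma mod_add_ne:
  fixes x s s' p :: nat
  assumes "x < p" "s < p" "s' < p" "s \<noteq> s'"
  shows "(x + s) mod p \<noteq> (x + s') mod p"
  using mod_add_cancel[of s p s' x] assms by (simp add: add.commute)

text \<open>
  The lower bounds on the degrees are what makes the vertices of a new layer recognisable as the
  only ones of degree 1, once it is matched with the last layer.
\<close>

definition extendable_graph :: "nat \<Rightarrow> nat \<Rightarrow> ((nat \<times> nat) set \<Rightarrow> nat) \<Rightarrow> bool" where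
  "extendable_graph p r E \<longleftrightarrow> colored_graph 2 (layers p r) E \<and>
    rot p r ` {..<p} = Aut (layers p r) E \<and>
    (\<forall>x<p. \<forall>i\<in>{1..r}. (if i = r then 1 else 2) \<le> card (nbhd (layers p r) E 1 (x, i)))"

lemma finite_nbhd: "finite V \<Longrightarrow> finite (nbhd V E c v)"
  by (simp add: nbhd_def)

section \<open>Starting graphs with two colours\<close>

text \<open>Both permutations of two points are rotations, and the single edge gives each point
  degree 1.\<close>

lemma extendable_graph_prime_2: "extendable_graph 2 1 (\<lambda>_. 1)"
proof -
  have ls: "layers 2 1 = {(0, 1), (1, 1)}" by (auto simp: layers_def)
  have "rot 2 1 ` {..<2} = Aut (layers 2 1) (\<lambda>_. 1)"
  proof (rule rot_image_eq_Aut)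
    fix f assume "f \<in> Aut (layers 2 1) (\<lambda>_. 1)"
    then have fp: "f permutes layers 2 1" by (simp add: Aut_iff)
    have m: "f (0, 1) \<in> {(0, 1), (1, 1)}" "f (1, 1) \<in> {(0, 1), (1, 1)}"
      using permutes_in_image[OF fp] ls by auto
    have "f (0, 1) \<noteq> f (1, 1)" using permutes_inj[OF fp] by (auto dest: injD)
    then have "f (0, 1) = (0, 1) \<and> f (1, 1) = (1, 1) \<or> f (0, 1) = (1, 1) \<and> f (1, 1) = (0, 1)"
      using m by auto
    then have "\<exists>t. \<forall>x<2. f (x, 1) = ((x + t) mod 2, 1)"
    proof
      assume "f (0, 1) = (0, 1) \<and> f (1, 1) = (1, 1)"
      then show ?thesis by (intro exI[of _ 0]) (simp add: less_2_cases_iff)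
    next
      assume "f (0, 1) = (1, 1) \<and> f (1, 1) = (0, 1)"
      then show ?thesis by (intro exI[of _ 1]) (auto simp: less_2_cases_iff)
    qed
    then show "\<exists>t. \<forall>x<2. \<forall>i\<in>{1..1}. f (x, i) = ((x + t) mod 2, i)"
      by (simp only: atLeastAtMost_singleton ball_simps simp_thms)
  qed auto
  moreover have "1 \<le> card (nbhd (layers 2 1) (\<lambda>_. 1) 1 (x, 1))" if "x < 2" for x
  proof -
    have "nbhd (layers 2 1) (\<lambda>_. 1) 1 (x, 1) = {(1 - x, 1)}"
      using that by (auto simp: nbhd_def ls less_2_cases_iff)
    then show ?thesis by simp
  qed
  ultimately show ?thesis by (auto simp: extendable_graph_def colored_graph_iff)
qed

text \<open>Degrees 2 and 3 in the second and third layers, against at least 4 in the first, tell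
  the layers apart. The matchings from first to second and from second to third make the three
  permutations equal, and the differences 0, 1 from first to third force them to commute with the
  successor.\<close>

lemma extendable_graph_3:
  assumes p: "p \<ge> 3" shows "\<exists>E. extendable_graph p 3 E"
proof -
  define s where "s = (\<lambda>x. (x + 1) mod p)"
  define R where "R = (\<lambda>(x, i) (y, j). i = (1::nat) \<and> j = (1::nat) \<or> i = 1 \<and> j = 2 \<and> y = x \<or>
    i = 2 \<and> j = 3 \<and> y = x \<or> i = 1 \<and> j = 3 \<and> (y = x \<or> y = s x))"
  define E :: "(nat \<times> nat) set \<Rightarrow> nat" where "E e = (if e \<in> edges_of R then 1 else 0)" for e
  let ?V = "layers p 3"
  have s: "s x < p" "s x \<noteq> x" if "x < p" for x
    using mod_add_ne[of x p 0 1] that p by (auto simp: s_def)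
  have s_eq: "s x = s y \<longleftrightarrow> x = y" if "x < p" "y < p" for x y
    unfolding s_def by (rule mod_add_cancel[OF that])
  have E: "E {u, v} = Suc 0 \<longleftrightarrow> R u v \<or> R v u" for u v by (simp add: E_def)
  have i3: "i = 1 \<or> i = 2 \<or> i = 3" if "i \<in> {1..3}" for i :: nat using that by auto
  have c2: "card (nbhd ?V E 1 (x, 2)) = 2" if x: "x < p" for x
  proof -
    have "nbhd ?V E 1 (x, 2) = {(x, 1), (x, 3)}"
      using x by (auto simp: nbhd_def E R_def)
    then show ?thesis by simp
  qed
  have c3: "card (nbhd ?V E 1 (x, 3)) = 3" if x: "x < p" for x
  proof -
    \<comment> \<open>The neighbours of \<open>(x, 3)\<close> in the first layer are at
      \<open>x\<close> and at its predecessor \<open>z\<close>.\<close>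
    obtain z where z: "z < p" "x = s z" using mod_predecessor[OF x] unfolding s_def .
    have "a = z" if "x = s a" "a < p" for a using s_eq[OF z(1) that(2)] z(2) that(1) by simp
    then have "nbhd ?V E 1 (x, 3) = {(x, 2), (x, 1), (z, 1)}"
      using x z by (auto simp: nbhd_def E R_def)
    moreover have "z \<noteq> x" using s(2)[OF z(1)] z(2) by simp
    ultimately show ?thesis by simp
  qed
  have c1: "card (nbhd ?V E 1 (x, 1)) \<ge> 4" if x: "x < p" for x
  proof -
    have "{(x, 2), (x, 3), (s x, 3), (s x, 1)} \<subseteq> nbhd ?V E 1 (x, 1)"
      using x s[OF x] by (auto simp: nbhd_def E R_def)
    then have "card {(x, 2::nat), (x, 3), (s x, 3), (s x, 1)} \<le> card (nbhd ?V E 1 (x, 1))"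
      by (intro card_mono finite_nbhd) auto
    then show ?thesis using s(2)[OF x] by simp
  qed
  have "rot p 3 ` {..<p} = Aut ?V E"
  proof (rule rot_image_eq_Aut)
    fix x i y j t assume "x < p" "y < p"
    then have "R ((x + t) mod p, i) ((y + t) mod p, j) = R (x, i) (y, j)"
      "R ((y + t) mod p, j) ((x + t) mod p, i) = R (y, j) (x, i)"
      unfolding R_def s_def by (simp_all only: rot_rel_iff rot_eq_iff prod.case)
    then show "E {((x + t) mod p, i), ((y + t) mod p, j)} = E {(x, i), (y, j)}"
      by (simp add: E_def)
  next
    fix f assume f: "f \<in> Aut ?V E"
    have layer: "\<forall>x<p. \<forall>y<p. \<forall>i\<in>{1..3}. \<forall>j\<in>{1..3}.
      card (nbhd ?V E 1 (x, i)) = card (nbhd ?V E 1 (y, j)) \<longrightarrow> i = j"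
    proof (intro allI ballI impI)
      fix x y i j :: nat
      assume x: "x < p" and y: "y < p" and ij: "i \<in> {1..3}" "j \<in> {1..3}"
        and c: "card (nbhd ?V E 1 (x, i)) = card (nbhd ?V E 1 (y, j))"
      show "i = j"
        using i3[OF ij(1)] i3[OF ij(2)] c c1[OF x] c2[OF x] c3[OF x] c1[OF y] c2[OF y] c3[OF y]
        by (elim disjE) simp_all
    qed
    obtain \<sigma> where \<sigma>: "\<forall>i\<in>{1..3}. inj_on (\<sigma> i) {..<p} \<and>
        (\<forall>x<p. f (x, i) = (\<sigma> i x, i) \<and> \<sigma> i x < p)"
      using layer_preserving[OF f layer] by (rule exE)
    have \<sigma>1: "f (x, i) = (\<sigma> i x, i)" "\<sigma> i x < p" if "x < p" "i \<in> {1..3}" for x i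
      using \<sigma> that by blast+
    have fE: "E {f u, f v} = E {u, v}" if "u \<in> ?V" "v \<in> ?V" "u \<noteq> v" for u v
      using f that unfolding Aut_iff by blast
    have adj: "R (\<sigma> i x, i) (\<sigma> j y, j)"
      if "R (x, i) (y, j)" "x < p" "y < p" "i \<in> {1..3}" "j \<in> {1..3}" "i < j" for x i y j
    proof -
      have "E {f (x, i), f (y, j)} = E {(x, i), (y, j)}" by (rule fE) (use that in simp_all)
      then have "E {(\<sigma> i x, i), (\<sigma> j y, j)} = Suc 0"
        using that(1) by (simp only: \<sigma>1(1)[OF that(2,4)] \<sigma>1(1)[OF that(3,5)] E simp_thms)
      then have "R (\<sigma> i x, i) (\<sigma> j y, j) \<or> R (\<sigma> j y, j) (\<sigma> i x, i)" by (simp only: E)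
      \<comment> \<open>\<open>R\<close> has no pair leading from a higher to a lower layer, so
        \<open>i < j\<close> settles the orientation.\<close>
      then show ?thesis using that(6) by (auto simp: R_def)
    qed
    have s2: "\<sigma> 2 x = \<sigma> 1 x" if "x < p" for x
      using adj[of x 1 x 2] that by (simp add: R_def)
    have s3: "\<sigma> 3 x = \<sigma> 1 x" if "x < p" for x
      using adj[of x 2 x 3] s2 that by (simp add: R_def)
    \<comment> \<open>The edge from \<open>(x, 1)\<close> to \<open>(s x, 3)\<close> leaves only
      \<open>\<sigma> 1 x\<close> and its successor as values of \<open>\<sigma> 1 (s x)\<close>;
      injectivity excludes the former.\<close>
    have step: "\<sigma> 1 (s x) = s (\<sigma> 1 x)" if x: "x < p" for x
    proof -
      have "inj_on (\<sigma> 1) {..<p}" using \<sigma> by simp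
      then have "\<sigma> 1 (s x) \<noteq> \<sigma> 1 x" using inj_onD[of "\<sigma> 1" "{..<p}" "s x" x] x s[OF x] by auto
      moreover have "R (\<sigma> 1 x, 1) (\<sigma> 3 (s x), 3)"
        by (rule adj) (use x s[OF x] in \<open>simp_all add: R_def\<close>)
      ultimately show ?thesis
        unfolding s3[OF s(1)[OF x]] by (simp add: R_def)
    qed
    define t where "t = \<sigma> 1 0"
    have s1: "\<sigma> 1 x = (x + t) mod p" if "x < p" for x
      unfolding t_def
    proof (rule rotation_from_step[OF _ _ _ that])
      show "\<sigma> 1 0 < p" using \<sigma>1(2)[of 0 1] p by simp
    qed (use p in simp, rule step[unfolded s_def])
    have "f (x, i) = ((x + t) mod p, i)" if x: "x < p" and i: "i \<in> {1..3}" for x i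
      using \<sigma>1(1)[OF x i] s1[OF x] s2[OF x] s3[OF x] i3[OF i] by (elim disjE) simp_all
    then show "\<exists>t. \<forall>x<p. \<forall>i\<in>{1..3}. f (x, i) = ((x + t) mod p, i)" by blast
  qed (use p in simp)
  moreover have "(if i = 3 then 1 else 2) \<le> card (nbhd ?V E 1 (x, i))" if "x < p" "i \<in> {1..3}" for x i
    using i3[OF that(2)] c1[OF that(1)] c2[OF that(1)] c3[OF that(1)] by (elim disjE) simp_all
  ultimately have "extendable_graph p 3 E"
    unfolding extendable_graph_def by (simp add: colored_graph_iff E_def)
  then show ?thesis by blast
qed

lemma nat_mod_eq_imp_dvd:
  fixes x y s p :: nat
  assumes "y = (x + s) mod p"
  shows "int p dvd int y - int x - int s"
proof -
  have "int y = (int x + int s) mod int p" using assms by (simp add: zmod_int)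
  then have "(int x + int s) mod int p = int y mod int p" by simp
  then show ?thesis by (metis diff_diff_eq mod_eq_dvd_iff)
qed

text \<open>
  In the graph on two layers below, D is the position of a vertex of the second layer relative to
  one end of a path of length 3 in the first. An automorphism either preserves the direction of the
  cycle on the first layer, and then the next lemma fixes D, or reverses it, which the lemma after it
  excludes.
\<close>

lemma difference_set_unique:
  fixes P D :: int
  assumes P: "P \<ge> 7"
    and a: "P dvd D - a" "a \<in> {0, 1, 3}"
    and b: "P dvd D - 2 - b" "b \<in> {0, 1, 3}"
  shows "a = 3"
proof (rule ccontr)
  assume "a \<noteq> 3"
  then have a': "a \<in> {0, 1}" using a by auto
  \<comment> \<open>Subtracting eliminates \<open>D\<close>. With \<open>a\<close> in 0, 1, the
    multiple \<open>2 + b - a\<close> of \<open>P\<close> lies between 1 and 5.\<close>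
  have "P dvd (D - a) - (D - 2 - b)" by (rule dvd_diff[OF a(1) b(1)])
  then have "P dvd 2 + b - a" by (simp add: algebra_simps)
  moreover have "0 < 2 + b - a" "2 + b - a \<le> 5" using a' b(2) by auto
  ultimately show False using P zdvd_imp_le by fastforce
qed

lemma difference_set_not_reflected:
  fixes P D :: int
  assumes P: "P \<ge> 7"
    and a: "P dvd D - a" "a \<in> {0, 1, 3}"
    and b: "P dvd D - 1 - b" "b \<in> {0, 1, 3}"
    and c: "P dvd D - 3 - c" "c \<in> {0, 1, 3}"
  shows False
proof -
  have ab: "P dvd 1 + b - a"
    using dvd_diff[OF a(1) b(1)] by (simp add: algebra_simps)
  have ac: "P dvd 3 + c - a"
    using dvd_diff[OF a(1) c(1)] by (simp add: algebra_simps)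
  \<comment> \<open>Both multiples have absolute value at most 6, so they vanish. Then
    \<open>a = 3\<close>, \<open>c = 0\<close> and \<open>b = 2\<close>, which is not one of the
    differences.\<close>
  have z: "k = 0" if "P dvd k" "\<bar>k\<bar> < 7" for k
    using that P zdvd_not_zless[of k P] zdvd_not_zless[of "- k" P] by fastforce
  have "1 + b - a = 0" by (rule z[OF ab]) (use a b in auto)
  moreover have "3 + c - a = 0" by (rule z[OF ac]) (use a c in auto)
  ultimately show False using a b c by auto
qed

text \<open>A vertex of the second layer has at most three neighbours, one of the first at least
  four, so layers are kept. The cycle on the first layer leaves only rotations and reflections; the
  differences 0, 1, 3 exclude reflections and tie the second layer to the first.\<close>

lemma extendable_graph_2:
  assumes p: "p \<ge> 7" shows "\<exists>E. extendable_graph p 2 E"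
proof -
  define s where "s = (\<lambda>x. (x + 1) mod p)"
  define s3 where "s3 = (\<lambda>x. (x + 3) mod p)"
  define R where "R = (\<lambda>(x, i) (y, j). i = (1::nat) \<and> j = (1::nat) \<and> y = s x \<or>
    i = 1 \<and> j = 2 \<and> (y = x \<or> y = s x \<or> y = s3 x))"
  define E :: "(nat \<times> nat) set \<Rightarrow> nat" where "E e = (if e \<in> edges_of R then 1 else 0)" for e
  let ?V = "layers p 2"
  have s: "s x < p" "s x \<noteq> x" "s3 x < p" "s3 x \<noteq> x" "s x \<noteq> s3 x" "s (s x) \<noteq> x" if "x < p" for x
    using mod_add_ne[of x p 0 1] mod_add_ne[of x p 0 3] mod_add_ne[of x p 1 3]
      mod_add_ne[of x p 0 2] that p by (auto simp: s_def s3_def mod_simps)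
  have s_eq: "s x = s y \<longleftrightarrow> x = y" "s3 x = s3 y \<longleftrightarrow> x = y" if "x < p" "y < p" for x y
    unfolding s_def s3_def by (rule mod_add_cancel[OF that])+
  have E: "E {u, v} = Suc 0 \<longleftrightarrow> R u v \<or> R v u" for u v by (simp add: E_def)
  have i2: "i = 1 \<or> i = 2" if "i \<in> {1..2}" for i :: nat using that by auto
  have c2: "card (nbhd ?V E 1 (x, 2)) \<le> 3" "card (nbhd ?V E 1 (x, 2)) \<ge> 1" if x: "x < p" for x
  proof -
    obtain z where z: "z < p" "x = s z" using mod_predecessor[OF x] unfolding s_def .
    obtain w where w: "w < p" "x = s3 w" using mod_predecessor[OF x] unfolding s3_def .
    have "a = z" if "x = s a" "a < p" for a using s_eq(1)[OF z(1) that(2)] z(2) that(1) by simp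
    moreover have "a = w" if "x = s3 a" "a < p" for a
      using s_eq(2)[OF w(1) that(2)] w(2) that(1) by simp
    ultimately have n: "nbhd ?V E 1 (x, 2) = {(x, 1), (z, 1), (w, 1)}"
      using x z w by (auto simp: nbhd_def E R_def)
    show "card (nbhd ?V E 1 (x, 2)) \<le> 3"
      unfolding n by (rule card_insert_le_m1, simp, rule card_insert_le_m1) simp_all
    show "card (nbhd ?V E 1 (x, 2)) \<ge> 1"
      unfolding n by (simp add: card_insert_if)
  qed
  have c1: "card (nbhd ?V E 1 (x, 1)) \<ge> 4" if x: "x < p" for x
  proof -
    have "{(x, 2), (s x, 2), (s3 x, 2), (s x, 1)} \<subseteq> nbhd ?V E 1 (x, 1)"
      using x s[OF x] by (auto simp: nbhd_def E R_def)
    then have "card {(x, 2::nat), (s x, 2), (s3 x, 2), (s x, 1)} \<le> card (nbhd ?V E 1 (x, 1))"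
      by (intro card_mono finite_nbhd) auto
    then show ?thesis using s(2,4,5)[OF x] s(2)[OF x, symmetric] s(4)[OF x, symmetric] by simp
  qed
  have "rot p 2 ` {..<p} = Aut ?V E"
  proof (rule rot_image_eq_Aut)
    fix x i y j t assume "x < p" "y < p"
    then have "R ((x + t) mod p, i) ((y + t) mod p, j) = R (x, i) (y, j)"
      "R ((y + t) mod p, j) ((x + t) mod p, i) = R (y, j) (x, i)"
      unfolding R_def s_def s3_def by (simp_all only: rot_rel_iff rot_eq_iff prod.case)
    then show "E {((x + t) mod p, i), ((y + t) mod p, j)} = E {(x, i), (y, j)}"
      by (simp add: E_def)
  next
    fix f assume f: "f \<in> Aut ?V E"
    have layer: "\<forall>x<p. \<forall>y<p. \<forall>i\<in>{1..2}. \<forall>j\<in>{1..2}.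
      card (nbhd ?V E 1 (x, i)) = card (nbhd ?V E 1 (y, j)) \<longrightarrow> i = j"
    proof (intro allI ballI impI)
      fix x y i j :: nat
      assume x: "x < p" and y: "y < p" and ij: "i \<in> {1..2}" "j \<in> {1..2}"
        and c: "card (nbhd ?V E 1 (x, i)) = card (nbhd ?V E 1 (y, j))"
      show "i = j"
        using i2[OF ij(1)] i2[OF ij(2)] c c1[OF x] c2[OF x] c1[OF y] c2[OF y]
        by (elim disjE) simp_all
    qed
    obtain \<sigma> where \<sigma>: "\<forall>i\<in>{1..2}. inj_on (\<sigma> i) {..<p} \<and>
        (\<forall>x<p. f (x, i) = (\<sigma> i x, i) \<and> \<sigma> i x < p)"
      using layer_preserving[OF f layer] by (rule exE)
    have \<sigma>1: "f (x, i) = (\<sigma> i x, i)" "\<sigma> i x < p" if "x < p" "i \<in> {1..2}" for x i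
      using \<sigma> that by blast+
    have inj: "\<sigma> 1 x = \<sigma> 1 y \<Longrightarrow> x = y" if "x < p" "y < p" for x y
      using \<sigma> that inj_onD[of "\<sigma> 1" "{..<p}" x y] by simp
    have fE: "E {f u, f v} = E {u, v}" if "u \<in> ?V" "v \<in> ?V" "u \<noteq> v" for u v
      using f that unfolding Aut_iff by blast
    have adj: "R (\<sigma> i x, i) (\<sigma> j y, j) \<or> R (\<sigma> j y, j) (\<sigma> i x, i)"
      if "R (x, i) (y, j)" "x < p" "y < p" "i \<in> {1..2}" "j \<in> {1..2}" "(x, i) \<noteq> (y, j)" for x i y j
    proof -
      have "E {f (x, i), f (y, j)} = E {(x, i), (y, j)}" by (rule fE) (use that in simp_all)
      then have "E {(\<sigma> i x, i), (\<sigma> j y, j)} = Suc 0"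
        using that(1) by (simp only: \<sigma>1(1)[OF that(2,4)] \<sigma>1(1)[OF that(3,5)] E simp_thms)
      then show ?thesis by (simp only: E)
    qed
    have cyc: "\<sigma> 1 (s x) = s (\<sigma> 1 x) \<or> \<sigma> 1 x = s (\<sigma> 1 (s x))" if x: "x < p" for x
    proof -
      have "R (\<sigma> 1 x, 1) (\<sigma> 1 (s x), 1) \<or> R (\<sigma> 1 (s x), 1) (\<sigma> 1 x, 1)"
        by (rule adj) (use x s(1,2)[OF x] s(2)[OF x, symmetric] in \<open>simp_all add: R_def\<close>)
      then show ?thesis by (simp add: R_def)
    qed
    have adj2: "\<exists>a\<in>{0, 1, 3}. \<sigma> 2 y = (\<sigma> 1 x + a) mod p"
      if "y = x \<or> y = s x \<or> y = s3 x" "x < p" "y < p" for x y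
    proof -
      have "R (\<sigma> 1 x, 1) (\<sigma> 2 y, 2) \<or> R (\<sigma> 2 y, 2) (\<sigma> 1 x, 1)"
        by (rule adj) (use that in \<open>simp_all add: R_def\<close>)
      then have "\<sigma> 2 y = \<sigma> 1 x \<or> \<sigma> 2 y = s (\<sigma> 1 x) \<or> \<sigma> 2 y = s3 (\<sigma> 1 x)"
        by (simp add: R_def)
      then show ?thesis using \<sigma>1(2)[of x 1] that(2) by (auto simp: s_def s3_def)
    qed
    have adj3: "\<exists>a\<in>{0, 1, 3}. int p dvd int (\<sigma> 2 y) - int (\<sigma> 1 x) - a"
      if "y = x \<or> y = s x \<or> y = s3 x" "x < p" "y < p" for x y
      using adj2[OF that] nat_mod_eq_imp_dvd[of "\<sigma> 2 y" "\<sigma> 1 x" _ p] by fastforce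
    have ss3: "s3 x = s (s (s x))" for x by (simp add: s_def s3_def mod_simps numeral_3_eq_3)
    \<comment> \<open>The second-layer vertex at 3 is adjacent to the first-layer vertices at 3, 2
      and 0. A reversal sends these to \<open>\<sigma> 1 (s3 0)\<close> plus 0, 1 and 3, so
      \<open>D\<close>, \<open>D - 1\<close> and \<open>D - 3\<close> would all be among the
      differences modulo \<open>p\<close>.\<close>
    have no_flip: False if flip: "\<And>x. x < p \<Longrightarrow> \<sigma> 1 x = s (\<sigma> 1 (s x))"
    proof -
      have z: "0 < p" "s 0 < p" "s (s 0) < p" "s3 0 < p" using p s(1,3) by auto
      define D where "D = int (\<sigma> 2 (s3 0)) - int (\<sigma> 1 (s3 0))"
      have f1: "\<sigma> 1 (s (s 0)) = (\<sigma> 1 (s3 0) + 1) mod p"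
        using flip[OF z(3)] by (simp only: ss3 s_def)
      have f2: "\<sigma> 1 0 = (\<sigma> 1 (s3 0) + 3) mod p"
        using flip[OF z(1)] flip[OF z(2)] flip[OF z(3)] by (metis ss3 s3_def)
      have e1: "int p dvd int (\<sigma> 1 (s (s 0))) - int (\<sigma> 1 (s3 0)) - 1"
        using nat_mod_eq_imp_dvd[OF f1] by simp
      have e2: "int p dvd int (\<sigma> 1 0) - int (\<sigma> 1 (s3 0)) - 3"
        using nat_mod_eq_imp_dvd[OF f2] by simp
      obtain a where a: "a \<in> {0, 1, 3}" "int p dvd D - a"
        using adj3[of "s3 0" "s3 0"] z by (auto simp only: D_def)
      obtain b where b: "b \<in> {0, 1, 3}" "int p dvd int (\<sigma> 2 (s3 0)) - int (\<sigma> 1 (s (s 0))) - b"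
        using adj3[of "s3 0" "s (s 0)"] z ss3 by metis
      obtain c where c: "c \<in> {0, 1, 3}" "int p dvd int (\<sigma> 2 (s3 0)) - int (\<sigma> 1 0) - c"
        using adj3[of "s3 0" 0] z by metis
      have "int p dvd D - 1 - b" using dvd_add[OF b(2) e1] by (simp add: D_def algebra_simps)
      moreover have "int p dvd D - 3 - c" using dvd_add[OF c(2) e2] by (simp add: D_def algebra_simps)
      ultimately show False
        using difference_set_not_reflected[of "int p" D a b c] p a b(1) c(1) by simp
    qed
    have all: "\<forall>x<p. P x" if "P 0" "\<And>x. x < p \<Longrightarrow> P x \<Longrightarrow> P (s x)" for P
    proof (intro allI impI)
      fix x assume "x < p"
      then show "P x"
      proof (induction x)
        case (Suc x)
        then show ?case using that(2)[of x] by (simp add: s_def)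
      qed (use that in simp)
    qed
    have step: "\<sigma> 1 (s x) = s (\<sigma> 1 x)" if x: "x < p" for x
    proof -
      \<comment> \<open>Injectivity forbids doubling back, so the direction taken at 0 persists
        round the whole cycle.\<close>
      have ne: "\<sigma> 1 (s (s x)) \<noteq> \<sigma> 1 x" if "x < p" for x
        using inj[OF s(1)[OF s(1)[OF that]] that] s(6)[OF that] by blast
      have "\<forall>x<p. \<sigma> 1 x = s (\<sigma> 1 (s x))" if "\<sigma> 1 0 = s (\<sigma> 1 (s 0))"
        using that by (rule all) (metis cyc ne s(1))
      moreover have "\<forall>x<p. \<sigma> 1 (s x) = s (\<sigma> 1 x)" if "\<sigma> 1 (s 0) = s (\<sigma> 1 0)"
      proof (rule all, rule that)
        fix x assume x: "x < p" "\<sigma> 1 (s x) = s (\<sigma> 1 x)"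
        have "\<sigma> 1 (s x) \<noteq> s (\<sigma> 1 (s (s x)))"
          using x(2) ne[OF x(1)] s_eq(1) \<sigma>1(2)[of _ 1] s(1) x(1) by auto
        then show "\<sigma> 1 (s (s x)) = s (\<sigma> 1 (s x))" using cyc[OF s(1)[OF x(1)]] by blast
      qed
      moreover have "\<sigma> 1 (s 0) = s (\<sigma> 1 0) \<or> \<sigma> 1 0 = s (\<sigma> 1 (s 0))"
        by (rule cyc) (use p in simp)
      ultimately show ?thesis using no_flip x by blast
    qed
    define t where "t = \<sigma> 1 0"
    have s1: "\<sigma> 1 x = (x + t) mod p" if "x < p" for x
      unfolding t_def
    proof (rule rotation_from_step[OF _ _ _ that])
      show "\<sigma> 1 0 < p" using \<sigma>1(2)[of 0 1] p by simp
    qed (use p in simp, rule step[unfolded s_def])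
    have s2: "\<sigma> 2 x = (x + t) mod p" if x: "x < p" for x
    proof -
      \<comment> \<open>With \<open>x = z + 3\<close>, the vertex \<open>(x, 2)\<close> is adjacent
        to the first-layer vertices at \<open>z\<close> and \<open>z + 2\<close>. So
        \<open>D\<close> and \<open>D - 2\<close> are both among the differences modulo
        \<open>p\<close>, which forces \<open>D\<close> to be 3.\<close>
      obtain z where z: "z < p" "x = s3 z" using mod_predecessor[OF x] unfolding s3_def .
      have z': "s z < p" "s (s z) < p" using z s(1) by auto
      define D where "D = int (\<sigma> 2 x) - int (\<sigma> 1 z)"
      have f1: "\<sigma> 1 (s (s z)) = (\<sigma> 1 z + 2) mod p"
        unfolding step[OF z'(1)] step[OF z(1)] by (simp add: s_def mod_simps)
      have e1: "int p dvd int (\<sigma> 1 (s (s z))) - int (\<sigma> 1 z) - 2"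
        using nat_mod_eq_imp_dvd[OF f1] by simp
      obtain a where a: "a \<in> {0, 1, 3}" "\<sigma> 2 x = (\<sigma> 1 z + a) mod p"
        using adj2[of x z] x z by metis
      obtain b where b: "b \<in> {0, 1, 3}" "int p dvd int (\<sigma> 2 x) - int (\<sigma> 1 (s (s z))) - b"
        using adj3[of x "s (s z)"] x z z' ss3 by metis
      have "int p dvd D - int a" using nat_mod_eq_imp_dvd[OF a(2)] by (simp add: D_def)
      moreover have "int p dvd D - 2 - b" using dvd_add[OF b(2) e1] by (simp add: D_def algebra_simps)
      ultimately have "int a = 3"
        using difference_set_unique[of "int p" D "int a" b] p a(1) b(1) by auto
      then have "\<sigma> 2 x = ((z + t) mod p + 3) mod p" using a(2) s1[OF z(1)] by simp
      also have "\<dots> = (x + t) mod p" unfolding z(2) s3_def by (simp add: mod_simps ac_simps)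
      finally show ?thesis .
    qed
    have "f (x, i) = ((x + t) mod p, i)" if x: "x < p" and i: "i \<in> {1..2}" for x i
      using \<sigma>1(1)[OF x i] s1[OF x] s2[OF x] i2[OF i] by (elim disjE) simp_all
    then show "\<exists>t. \<forall>x<p. \<forall>i\<in>{1..2}. f (x, i) = ((x + t) mod p, i)" by blast
  qed (use p in simp)
  moreover have "(if i = 2 then 1 else 2) \<le> card (nbhd ?V E 1 (x, i))" if "x < p" "i \<in> {1..2}" for x i
    using i2[OF that(2)] c1[OF that(1)] c2[OF that(1)] by (elim disjE) simp_all
  ultimately have "extendable_graph p 2 E"
    unfolding extendable_graph_def by (simp add: colored_graph_iff E_def)
  then show ?thesis by blast
qed

section \<open>Adding a layer by a perfect matching\<close>

text \<open>Only vertices of the new layer have degree 1, so an automorphism restricts to the old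
  graph. There it is a rotation, and the matching copies that rotation to the new layer.\<close>

lemma extendable_graph_Suc:
  assumes E: "extendable_graph p r E" and p: "p > 0" and r: "r \<ge> 1"
  shows "\<exists>F. extendable_graph p (Suc r) F"
proof -
  let ?V = "layers p r" and ?W = "layers p (Suc r)"
  \<comment> \<open>A pair meeting the new layer has colour 1 exactly when it belongs to the
    matching with layer \<open>r\<close>; all other pairs keep their colour.\<close>
  define F where "F e = (if \<exists>x. (x, Suc r) \<in> e then if \<exists>x. e = {(x, r), (x, Suc r)} then 1 else 0
    else E e)" for e
  have Eg: "colored_graph 2 ?V E" and EA: "rot p r ` {..<p} = Aut ?V E"
    and Ed: "\<And>x i. x < p \<Longrightarrow> i \<in> {1..r} \<Longrightarrow> (if i = r then 1 else 2) \<le> card (nbhd ?V E 1 (x, i))"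
    using E by (auto simp: extendable_graph_def)
  have old: "F {(x, i), (y, j)} = E {(x, i), (y, j)}" if "i \<le> r" "j \<le> r" for x y i j
    using that by (auto simp: F_def)
  have new: "F {(x, i), (y, Suc r)} = (if x = y \<and> i = r then 1 else 0)"
    "F {(y, Suc r), (x, i)} = (if x = y \<and> i = r then 1 else 0)" for x y i
    by (auto simp: F_def doubleton_eq_iff)
  have W: "v \<in> ?W \<longleftrightarrow> v \<in> ?V \<or> (\<exists>x<p. v = (x, Suc r))" for v
    by (cases v) (auto simp: le_Suc_eq)
  \<comment> \<open>Layer \<open>r\<close> gains its matching edge, which raises its lower bound
    from 1 to 2; earlier layers have 2 already.\<close>
  have cold: "2 \<le> card (nbhd ?W F 1 (x, i))" if x: "x < p" and i: "i \<in> {1..r}" for x i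
  proof -
    have sub: "nbhd ?V E 1 (x, i) \<subseteq> nbhd ?W F 1 (x, i)"
      using i by (auto simp: nbhd_def old)
    show ?thesis
    proof (cases "i = r")
      case True
      have "(x, Suc r) \<notin> nbhd ?V E 1 (x, i)" by (simp add: nbhd_def)
      then have "Suc (card (nbhd ?V E 1 (x, i))) = card (insert (x, Suc r) (nbhd ?V E 1 (x, i)))"
        by (simp add: finite_nbhd)
      also have "\<dots> \<le> card (nbhd ?W F 1 (x, i))"
        using sub x True by (intro card_mono finite_nbhd) (auto simp: nbhd_def new)
      finally show ?thesis using Ed[OF x i] True by simp
    next
      case False
      then show ?thesis
        using Ed[OF x i] card_mono[OF finite_nbhd[OF finite_layers] sub] by simp
    qed
  qed
  have cnew: "card (nbhd ?W F 1 (x, Suc r)) = 1" if x: "x < p" for x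
  proof -
    have "nbhd ?W F 1 (x, Suc r) = {(x, r)}"
      using x r by (auto simp: nbhd_def new split: if_splits)
    then show ?thesis by simp
  qed
  have "rot p (Suc r) ` {..<p} = Aut ?W F"
  proof (rule rot_image_eq_Aut[OF p])
    fix x i y j t assume *: "x < p" "y < p" "i \<in> {1..Suc r}" "j \<in> {1..Suc r}" "t < p" "(x, i) \<noteq> (y, j)"
    show "F {((x + t) mod p, i), ((y + t) mod p, j)} = F {(x, i), (y, j)}"
    proof (cases "i = Suc r \<or> j = Suc r")
      case True
      then show ?thesis using rot_eq_iff[OF *(1,2)] rot_eq_iff[OF *(2,1)] by (elim disjE) (simp_all add: new)
    next
      case False
      then have ij: "i \<le> r" "j \<le> r" "i \<ge> 1" "j \<ge> 1" using * by auto
      have "rot p r t \<in> Aut ?V E" using EA *(5) by blast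
      then have rE: "E {rot p r t u, rot p r t v} = E {u, v}" if "u \<in> ?V" "v \<in> ?V" "u \<noteq> v" for u v
        using that unfolding Aut_iff by blast
      have "E {rot p r t (x, i), rot p r t (y, j)} = E {(x, i), (y, j)}"
        by (rule rE) (use * ij in simp_all)
      then show ?thesis using * ij by (simp add: old)
    qed
  next
    fix f assume f: "f \<in> Aut ?W F"
    have fp: "f permutes ?W" using f by (simp add: Aut_iff)
    have fF: "F {f u, f v} = F {u, v}" if "u \<in> ?W" "v \<in> ?W" "u \<noteq> v" for u v
      using f that unfolding Aut_iff by blast
    have layer: "i = Suc r \<longleftrightarrow> j = Suc r" if xi: "(x, i) \<in> ?W" and y: "f (x, i) = (y, j)" for x i y j
    proof -
      have yj: "(y, j) \<in> ?W" using permutes_in_image[OF fp, of "(x, i)"] xi y by simp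
      have "card (nbhd ?W F 1 (y, j)) = card (nbhd ?W F 1 (x, i))"
        using card_nbhd_Aut[OF f xi, of 1] y by simp
      then show ?thesis
        using cold[of x i] cold[of y j] cnew[of x] cnew[of y] xi yj
        by (cases "i = Suc r"; cases "j = Suc r") auto
    qed
    \<comment> \<open>The restriction of \<open>f\<close> to the old layers, made the identity
      elsewhere so that it can be compared with \<open>rot p r t\<close> as a function.\<close>
    define g where "g v = (if v \<in> ?V then f v else v)" for v
    have gV: "f v \<in> ?V" if "v \<in> ?V" for v
    proof -
      obtain x i y j where v: "v = (x, i)" "f v = (y, j)" by fastforce
      have "f v \<in> ?W" using permutes_in_image[OF fp, of v] that v by auto
      then show ?thesis using layer[of x i y j] v that by auto
    qed
    have "g permutes ?V"
    proof (rule bij_imp_permutes)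
      have inj: "inj_on g ?V"
        using permutes_inj[OF fp] by (auto simp: g_def inj_on_def dest: injD)
      have "g ` ?V \<subseteq> ?V" using gV by (auto simp: g_def)
      then show "bij_betw g ?V ?V"
        using inj by (simp add: bij_betw_def endo_inj_surj)
    qed (simp add: g_def)
    moreover have "E {g u, g v} = E {u, v}" if uv: "u \<in> ?V" "v \<in> ?V" "u \<noteq> v" for u v
    proof -
      have "F {a, b} = E {a, b}" if "a \<in> ?V" "b \<in> ?V" for a b
        using that by (cases a; cases b) (simp add: old)
      then show ?thesis using fF[of u v] uv gV by (simp add: g_def W)
    qed
    ultimately have "g \<in> rot p r ` {..<p}" unfolding EA Aut_iff by blast
    then obtain t where t: "g = rot p r t" by blast
    have ft: "f (x, i) = ((x + t) mod p, i)" if "x < p" "i \<in> {1..r}" for x i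
      using fun_cong[OF t, of "(x, i)"] that by (simp add: g_def)
    have fn: "f (x, Suc r) = ((x + t) mod p, Suc r)" if x: "x < p" for x
    proof -
      obtain y j where y: "f (x, Suc r) = (y, j)" by fastforce
      have j: "j = Suc r" using layer[OF _ y] x by simp
      have fr: "f (x, r) = ((x + t) mod p, r)" by (rule ft) (use x r in simp_all)
      \<comment> \<open>The matching edge at \<open>(x, r)\<close> must go to the only matching edge
        at \<open>f (x, r)\<close>.\<close>
      have "F {f (x, r), f (x, Suc r)} = F {(x, r), (x, Suc r)}" by (rule fF) (use x r in simp_all)
      then have "F {((x + t) mod p, r), (y, Suc r)} = 1" unfolding fr y j new(1) by simp
      then show ?thesis unfolding y j new(1) by (simp split: if_splits)
    qed
    have "f (x, i) = ((x + t) mod p, i)" if "x < p" "i \<in> {1..Suc r}" for x i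
      using ft[of x i] fn[of x] that by (cases "i = Suc r") auto
    then show "\<exists>t. \<forall>x<p. \<forall>i\<in>{1..Suc r}. f (x, i) = ((x + t) mod p, i)" by blast
  qed
  moreover have "colored_graph 2 ?W F"
    unfolding colored_graph_iff
  proof (intro conjI ballI impI)
    fix u v assume uv: "u \<in> ?W" "v \<in> ?W" "u \<noteq> v"
    show "F {u, v} < 2"
    proof (cases "u \<in> ?V \<and> v \<in> ?V")
      case True
      then have "F {u, v} = E {u, v}" by (cases u; cases v) (simp add: old)
      then show ?thesis using Eg True uv(3) by (simp add: colored_graph_iff)
    next
      case False
      then show ?thesis using uv(1,2) unfolding W by (cases u; cases v) (auto simp: new)
    qed
  qed simp
  moreover have "(if i = Suc r then 1 else 2) \<le> card (nbhd ?W F 1 (x, i))"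
    if "x < p" "i \<in> {1..Suc r}" for x i
    using cold[of x i] cnew[of x] that by (cases "i = Suc r") auto
  ultimately have "extendable_graph p (Suc r) F"
    unfolding extendable_graph_def by blast
  then show ?thesis by blast
qed

section \<open>Two layers with three colours\<close>

text \<open>Colour 0 on the whole first layer but not inside the second makes the degrees in colour
  0 differ. Between the layers, colour 0 at difference 0 gives
  \<open>\<sigma> 2 = \<sigma> 1\<close> on residues, and colour 1 at difference 1 makes this map
  commute with the successor.\<close>

lemma three_colored_parallel_product_2:
  assumes p: "p \<ge> 2"
  shows "\<exists>E. colored_graph 3 (layers p 2) E \<and> rot p 2 ` {..<p} = Aut (layers p 2) E"
proof -
  define s where "s = (\<lambda>x. (x + 1) mod p)"
  define R0 where "R0 = (\<lambda>(x, i) (y, j). i = (1::nat) \<and> j = (1::nat) \<or> i = 1 \<and> j = 2 \<and> y = (x::nat))"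
  define R1 where "R1 = (\<lambda>(x, i) (y, j). i = (2::nat) \<and> j = (2::nat) \<or> i = 1 \<and> j = 2 \<and> y = s x)"
  define E :: "(nat \<times> nat) set \<Rightarrow> nat" where
    "E e = (if e \<in> edges_of R0 then 0 else if e \<in> edges_of R1 then 1 else 2)" for e
  let ?V = "layers p 2"
  have s: "s x < p" "s x \<noteq> x" if "x < p" for x
    using mod_add_ne[of x p 0 1] that p by (auto simp: s_def)
  have E0: "E {u, v} = 0 \<longleftrightarrow> R0 u v \<or> R0 v u" for u v by (simp add: E_def)
  have E1: "E {u, v} = 1 \<longleftrightarrow> \<not> (R0 u v \<or> R0 v u) \<and> (R1 u v \<or> R1 v u)" for u v by (simp add: E_def)
  have i2: "i = 1 \<or> i = 2" if "i \<in> {1..2}" for i :: nat using that by auto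
  have c1: "card (nbhd ?V E 0 (x, 1)) \<ge> 2" if x: "x < p" for x
  proof -
    have "{(x, 2), (s x, 1)} \<subseteq> nbhd ?V E 0 (x, 1)"
      using x s[OF x] by (auto simp: nbhd_def E0 R0_def)
    then have "card {(x, 2::nat), (s x, 1)} \<le> card (nbhd ?V E 0 (x, 1))"
      by (intro card_mono finite_nbhd) auto
    then show ?thesis by simp
  qed
  have c2: "card (nbhd ?V E 0 (x, 2)) = 1" if x: "x < p" for x
  proof -
    have "nbhd ?V E 0 (x, 2) = {(x, 1)}"
      using x by (auto simp: nbhd_def E0 R0_def)
    then show ?thesis by simp
  qed
  have "rot p 2 ` {..<p} = Aut ?V E"
  proof (rule rot_image_eq_Aut)
    fix x i y j t assume "x < p" "y < p"
    then have "R0 ((x + t) mod p, i) ((y + t) mod p, j) = R0 (x, i) (y, j)"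
      "R0 ((y + t) mod p, j) ((x + t) mod p, i) = R0 (y, j) (x, i)"
      "R1 ((x + t) mod p, i) ((y + t) mod p, j) = R1 (x, i) (y, j)"
      "R1 ((y + t) mod p, j) ((x + t) mod p, i) = R1 (y, j) (x, i)"
      unfolding R0_def R1_def s_def by (simp_all only: rot_rel_iff rot_eq_iff prod.case)
    then show "E {((x + t) mod p, i), ((y + t) mod p, j)} = E {(x, i), (y, j)}"
      by (simp add: E_def)
  next
    fix f assume f: "f \<in> Aut ?V E"
    have layer: "\<forall>x<p. \<forall>y<p. \<forall>i\<in>{1..2}. \<forall>j\<in>{1..2}.
      card (nbhd ?V E 0 (x, i)) = card (nbhd ?V E 0 (y, j)) \<longrightarrow> i = j"
    proof (intro allI ballI impI)
      fix x y i j :: nat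
      assume x: "x < p" and y: "y < p" and ij: "i \<in> {1..2}" "j \<in> {1..2}"
        and c: "card (nbhd ?V E 0 (x, i)) = card (nbhd ?V E 0 (y, j))"
      show "i = j"
        using i2[OF ij(1)] i2[OF ij(2)] c c1[OF x] c2[OF x] c1[OF y] c2[OF y]
        by (elim disjE) simp_all
    qed
    obtain \<sigma> where \<sigma>: "\<forall>i\<in>{1..2}. inj_on (\<sigma> i) {..<p} \<and>
        (\<forall>x<p. f (x, i) = (\<sigma> i x, i) \<and> \<sigma> i x < p)"
      using layer_preserving[OF f layer] by (rule exE)
    have \<sigma>1: "f (x, i) = (\<sigma> i x, i)" "\<sigma> i x < p" if "x < p" "i \<in> {1..2}" for x i
      using \<sigma> that by blast+
    have fE: "E {(\<sigma> 1 x, 1), (\<sigma> 2 y, 2)} = E {(x, 1), (y, 2)}" if "x < p" "y < p" for x y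
    proof -
      have "E {f u, f v} = E {u, v}" if "u \<in> ?V" "v \<in> ?V" "u \<noteq> v" for u v
        using f that unfolding Aut_iff by blast
      from this[of "(x, 1)" "(y, 2)"] show ?thesis
        using that \<sigma>1(1)[of x 1] \<sigma>1(1)[of y 2] by simp
    qed
    have s2: "\<sigma> 2 x = \<sigma> 1 x" if x: "x < p" for x
    proof -
      have "E {(\<sigma> 1 x, 1), (\<sigma> 2 x, 2)} = 0" unfolding fE[OF x x] E0 by (simp add: R0_def)
      then show ?thesis unfolding E0 by (simp add: R0_def)
    qed
    have step: "\<sigma> 1 (s x) = s (\<sigma> 1 x)" if x: "x < p" for x
    proof -
      have "E {(\<sigma> 1 x, 1), (\<sigma> 2 (s x), 2)} = 1"
        unfolding fE[OF x s(1)[OF x]] E1 using s(2)[OF x] by (simp add: R0_def R1_def)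
      then show ?thesis unfolding E1 s2[OF s(1)[OF x]] by (simp add: R1_def)
    qed
    define t where "t = \<sigma> 1 0"
    have s1: "\<sigma> 1 x = (x + t) mod p" if "x < p" for x
      unfolding t_def
    proof (rule rotation_from_step[OF _ _ _ that])
      show "\<sigma> 1 0 < p" using \<sigma>1(2)[of 0 1] p by simp
    qed (use p in simp, rule step[unfolded s_def])
    have "f (x, i) = ((x + t) mod p, i)" if x: "x < p" and i: "i \<in> {1..2}" for x i
      using \<sigma>1(1)[OF x i] s1[OF x] s2[OF x] i2[OF i] by (elim disjE) simp_all
    then show "\<exists>t. \<forall>x<p. \<forall>i\<in>{1..2}. f (x, i) = ((x + t) mod p, i)" by blast
  qed (use p in simp)
  then show ?thesis by (intro exI[of _ E]) (simp add: colored_graph_iff E_def)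
qed

section \<open>Reflections and the negative results\<close>

text \<open>The reflection \<open>m - x\<close> of the residues; adding \<open>p\<close> keeps the
  truncated subtraction exact for \<open>x < p\<close>.\<close>

definition refl_mod :: "nat \<Rightarrow> nat \<Rightarrow> nat \<Rightarrow> nat" where
  "refl_mod p m x = (m + p - x) mod p"

lemma refl_mod_less: "p > 0 \<Longrightarrow> refl_mod p m x < p"
  unfolding refl_mod_def by (rule mod_less_divisor)

lemma refl_mod_add: "x < p \<Longrightarrow> (refl_mod p m x + x) mod p = m mod p"
proof -
  assume "x < p"
  then have "m + p - x + x = m + p" by simp
  then show ?thesis unfolding refl_mod_def by (simp only: mod_add_left_eq mod_add_self2)
qed

lemma refl_mod_unique:
  assumes "x < p" "y < p" "(y + x) mod p = m mod p"
  shows "y = refl_mod p m x"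
proof -
  have "refl_mod p m x < p" using assms(1) by (intro refl_mod_less) simp
  moreover have "(y + x) mod p = (refl_mod p m x + x) mod p"
    using assms(3) refl_mod_add[OF assms(1)] by simp
  ultimately show ?thesis using mod_add_cancel[OF assms(2)] by blast
qed

lemma refl_mod_refl_mod: "x < p \<Longrightarrow> refl_mod p m (refl_mod p m x) = x"
proof -
  assume x: "x < p"
  then have "refl_mod p m x < p" by (intro refl_mod_less) simp
  then show ?thesis
    using refl_mod_unique[OF _ x] refl_mod_add[OF x] by (metis add.commute)
qed

text \<open>
  An invariant colouring is preserved by reflecting each layer, as soon as the reflections
  \<open>x \<mapsto> - x\<close> and \<open>y \<mapsto> c - y\<close> of the two layers are compatible on the edges
  between them.
\<close>

lemma reflection_not_excluded:
  fixes E :: "((nat \<times> nat) + nat) set \<Rightarrow> nat"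
  assumes p: "p \<ge> 3" and r: "r = 1 \<or> r = 2"
    and Aut: "fst (direct_sum (parallel_product (cyclic_regular p) r) (trivial_grp q)) =
      Aut (layers p r <+> {..<q}) E"
    and cross: "r = 2 \<Longrightarrow> \<forall>d<p. E {Inl (0, 1), Inl (refl_mod p c d, 2)} = E {Inl (0, 1), Inl (d, 2)}"
  shows False
proof -
  let ?W = "layers p r <+> {..<q}"
  have AutE: "Aut ?W E = (\<lambda>t. map_sum (rot p r t) id) ` {..<p}"
    unfolding Aut[symmetric] by (auto simp: direct_sum_def parallel_product_cyclic_eq trivial_grp_def)
  have inv: "E {map_sum (rot p r (t mod p)) id u, map_sum (rot p r (t mod p)) id v} = E {u, v}"
    if "u \<in> ?W" "v \<in> ?W" "u \<noteq> v" for t u v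
  proof -
    have "map_sum (rot p r (t mod p)) id \<in> Aut ?W E" unfolding AutE using p by auto
    then show ?thesis using that unfolding Aut_iff by blast
  qed
  have W: "Inl v \<in> ?W \<longleftrightarrow> v \<in> layers p r" "Inr k \<in> ?W \<longleftrightarrow> k < q" for v k
    by auto
  have rotE: "E {Inl ((x + t) mod p, i), Inl ((y + t) mod p, j)} = E {Inl (x, i), Inl (y, j)}"
    if "(x, i) \<in> layers p r" "(y, j) \<in> layers p r" "(x, i) \<noteq> (y, j)" for x i y j t
    using inv[of "Inl (x, i)" "Inl (y, j)" t, unfolded W] that by (simp add: mod_simps)
  have rotE': "E {Inl ((x + t) mod p, i), Inr k} = E {Inl (x, i), Inr k}"
    if "(x, i) \<in> layers p r" "k < q" for x i k t
    using inv[of "Inl (x, i)" "Inr k" t, unfolded W] that by (simp add: mod_simps)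
  \<comment> \<open>Layer 1 is reflected by \<open>x \<mapsto> - x\<close>, layer 2 by
    \<open>y \<mapsto> c - y\<close>.\<close>
  define m where "m i = (if i = 1 then 0 else c)" for i :: nat
  define f :: "(nat \<times> nat) + nat \<Rightarrow> (nat \<times> nat) + nat" where
    "f = map_sum (\<lambda>(x, i). if (x, i) \<in> layers p r then (refl_mod p (m i) x, i) else (x, i)) id"
  have f: "f (Inl (x, i)) = Inl (refl_mod p (m i) x, i)" if "(x, i) \<in> layers p r" for x i
    using that by (simp add: f_def)
  have ff: "f \<circ> f = id"
  proof
    fix v show "(f \<circ> f) v = id v"
      using p by (cases v) (auto simp: f_def refl_mod_refl_mod refl_mod_less split: if_splits)
  qed
  have "f v = v" if "v \<notin> ?W" for v
    using that by (cases v) (auto simp: f_def split: if_splits)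
  then have "f permutes ?W"
    unfolding permutes_def using o_bij[OF ff ff] by (simp add: bij_iff)
  moreover have "E {f u, f v} = E {u, v}" if uv: "u \<in> ?W" "v \<in> ?W" "u \<noteq> v" for u v
  proof -
    have same: "E {f (Inl (x, i)), f (Inl (y, i))} = E {Inl (x, i), Inl (y, i)}"
      if xy: "(x, i) \<in> layers p r" "(y, i) \<in> layers p r" "x \<noteq> y" for x y i
    proof -
      let ?x = "refl_mod p (m i) x" and ?y = "refl_mod p (m i) y"
      \<comment> \<open>Rotation by \<open>?y - x\<close> takes \<open>x\<close> to
        \<open>?y\<close> and \<open>y\<close> to \<open>?x\<close>: inside a layer, a reflected
        pair is a rotated pair with its ends exchanged.\<close>
      define t where "t = ?y + (p - x)"
      have x: "x < p" and y: "y < p" using xy by auto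
      have "(x + t) mod p = ?y" using x refl_mod_less[of p "m i" y] by (simp add: t_def)
      moreover have "(y + t) mod p = ?x"
      proof (rule refl_mod_unique[OF x])
        have "((y + t) mod p + x) mod p = (y + t + x) mod p" by (simp only: mod_add_left_eq)
        also have "y + t + x = ?y + y + p" using x by (simp add: t_def)
        also have "(?y + y + p) mod p = m i mod p" using refl_mod_add[OF y, of "m i"] by simp
        finally show "((y + t) mod p + x) mod p = m i mod p" .
      qed (use p in simp)
      ultimately show ?thesis
        using rotE[of x i y i t] xy f[OF xy(1)] f[OF xy(2)] by (simp add: insert_commute)
    qed
    have diff: "E {f (Inl (x, 1)), f (Inl (y, 2))} = E {Inl (x, 1), Inl (y, 2)}"
      if xy: "(x, 1) \<in> layers p r" "(y, 2) \<in> layers p r" for x y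
    proof -
      let ?x = "refl_mod p 0 x" and ?y = "refl_mod p c y"
      \<comment> \<open>Rotating the first-layer end to 0 reduces a cross edge to its difference
        \<open>d = y - x\<close>; the reflected edge has difference \<open>c - d\<close>, and
        \<open>cross\<close> compares the two.\<close>
      define d where "d = (y + (p - x)) mod p"
      have x: "x < p" and y: "y < p" and r2: "r = 2" using xy r by auto
      have d: "d < p" using p by (simp add: d_def)
      have "(?x + x) mod p = 0" using refl_mod_add[OF x, of 0] by simp
      moreover have "(?y + x) mod p = refl_mod p c d"
      proof (rule refl_mod_unique[OF d])
        have "((?y + x) mod p + d) mod p = (?y + x + (y + (p - x))) mod p"
          unfolding d_def by (simp only: mod_add_eq)
        also have "?y + x + (y + (p - x)) = ?y + y + p" using x by simp
        also have "(?y + y + p) mod p = c mod p" using refl_mod_add[OF y, of c] by simp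
        finally show "((?y + x) mod p + d) mod p = c mod p" .
      qed (use p in simp)
      ultimately have "E {Inl (?x, 1), Inl (?y, 2)} = E {Inl (0, 1), Inl (refl_mod p c d, 2)}"
        using rotE[of ?x 1 ?y 2 x] r2 refl_mod_less[of p] p by simp
      also have "\<dots> = E {Inl (0, 1), Inl (d, 2)}" using cross[OF r2] d by blast
      also have "\<dots> = E {Inl (x, 1), Inl (y, 2)}"
        using rotE[of x 1 y 2 "p - x"] xy x by (simp add: d_def)
      finally show ?thesis using f[OF xy(1)] f[OF xy(2)] by (simp add: m_def)
    qed
    \<comment> \<open>Rotations act transitively on a layer, so all its edges to a given fixed point
      have the same colour.\<close>
    have fixed: "E {f (Inl (x, i)), f (Inr k)} = E {Inl (x, i), Inr k}"
      if xk: "(x, i) \<in> layers p r" "k < q" for x i k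
    proof -
      have "(x + (refl_mod p (m i) x + (p - x))) mod p = refl_mod p (m i) x"
        using xk refl_mod_less[of p "m i" x] by simp
      then show ?thesis
        using rotE'[OF xk, of "refl_mod p (m i) x + (p - x)"] f[OF xk(1)] by (simp add: f_def)
    qed
    show ?thesis
    proof (cases u)
      case u: (Inl a)
      obtain x i where a: "a = (x, i)" by fastforce
      have xi: "(x, i) \<in> layers p r" using uv u a by auto
      show ?thesis
      proof (cases v)
        case v: (Inl b)
        obtain y j where b: "b = (y, j)" by fastforce
        have yj: "(y, j) \<in> layers p r" using uv v b by auto
        consider "i = j" | "i = 1" "j = 2" | "i = 2" "j = 1" using xi yj r by fastforce
        then show ?thesis
        proof cases
          case 1
          then show ?thesis using same xi yj uv u v a b by auto
        next
          case 2
          then show ?thesis using diff xi yj u v a b by auto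
        next
          case 3
          then show ?thesis using diff[of y x] xi yj u v a b by (auto simp: insert_commute)
        qed
      next
        case (Inr k)
        then show ?thesis using fixed[OF xi] uv u a by auto
      qed
    next
      case u: (Inr k)
      show ?thesis
      proof (cases v)
        case v: (Inl b)
        obtain y j where b: "b = (y, j)" by fastforce
        have yj: "(y, j) \<in> layers p r" using uv v b by auto
        then show ?thesis using fixed[OF yj] uv u v b by (auto simp: insert_commute)
      next
        case (Inr l)
        then show ?thesis using u by (simp add: f_def)
      qed
    qed
  qed
  ultimately have "f \<in> Aut ?W E" by (simp add: Aut_iff)
  \<comment> \<open>The reflection would be a rotation. Fixing \<open>(0, 1)\<close> it would be the
    identity, but it sends \<open>(1, 1)\<close> to \<open>(p - 1, 1)\<close>.\<close>
  then obtain t where t: "t < p" "f = map_sum (rot p r t) id" unfolding AutE by auto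
  have l: "(0, 1) \<in> layers p r" "(1, 1) \<in> layers p r" using p r by auto
  have "refl_mod p 0 0 = t" using fun_cong[OF t(2), of "Inl (0, 1)"] f[OF l(1)] l t(1) by (simp add: m_def)
  then have "t = 0" by (simp add: refl_mod_def)
  then have "refl_mod p 0 1 = 1" using fun_cong[OF t(2), of "Inl (1, 1)"] f[OF l(2)] l by (simp add: m_def)
  then show False using p by (simp add: refl_mod_def)
qed

text \<open>One colour class has at most one element for \<open>p = 3\<close> and at most two for
  \<open>p = 5\<close>. A reflection fixing its only element, or exchanging its two elements,
  preserves that class and hence also its complement.\<close>

lemma two_coloring_symmetric:
  fixes col :: "nat \<Rightarrow> nat"
  assumes p: "p = 3 \<or> p = 5" and col: "\<And>d. d < p \<Longrightarrow> col d < 2"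
  shows "\<exists>c. \<forall>d<p. col (refl_mod p c d) = col d"
  using p
proof
  assume p3: "p = 3"
  have l: "d = 0 \<or> d = 1 \<or> d = 2" if "d < 3" for d :: nat using that by auto
  have "col 1 = col 2 \<or> col 0 = col 1 \<or> col 0 = col 2"
    using col[of 0] col[of 1] col[of 2] p3 by simp linarith
  then show ?thesis
  proof (elim disjE)
    assume "col 1 = col 2"
    then show ?thesis by (intro exI[of _ 0]) (auto simp: p3 refl_mod_def dest!: l)
  next
    assume "col 0 = col 1"
    then show ?thesis by (intro exI[of _ 1]) (auto simp: p3 refl_mod_def dest!: l)
  next
    assume "col 0 = col 2"
    then show ?thesis by (intro exI[of _ 2]) (auto simp: p3 refl_mod_def dest!: l)
  qed
next
  assume p5: "p = 5"
  have l: "d = 0 \<or> d = 1 \<or> d = 2 \<or> d = 3 \<or> d = 4" if "d < 5" for d :: nat using that by auto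
  have "col d = 0 \<or> col d = 1" if "d < 5" for d using col[of d] that p5 by auto
  then have "col 0 = 0 \<or> col 0 = 1" "col 1 = 0 \<or> col 1 = 1" "col 2 = 0 \<or> col 2 = 1"
    "col 3 = 0 \<or> col 3 = 1" "col 4 = 0 \<or> col 4 = 1"
    by simp_all
  \<comment> \<open>The five alternatives are the reflections for \<open>c = 0, ..., 4\<close>: the
    listed pairs have sum \<open>c\<close> modulo 5, and the remaining residue is fixed.\<close>
  then have "col 1 = col 4 \<and> col 2 = col 3 \<or> col 0 = col 1 \<and> col 2 = col 4 \<or>
    col 0 = col 2 \<and> col 3 = col 4 \<or> col 0 = col 3 \<and> col 1 = col 2 \<or> col 0 = col 4 \<and> col 1 = col 3"
    by (elim disjE) simp_all
  then show ?thesis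
  proof (elim disjE)
    assume "col 1 = col 4 \<and> col 2 = col 3"
    then show ?thesis by (intro exI[of _ 0]) (auto simp: p5 refl_mod_def dest!: l)
  next
    assume "col 0 = col 1 \<and> col 2 = col 4"
    then show ?thesis by (intro exI[of _ 1]) (auto simp: p5 refl_mod_def dest!: l)
  next
    assume "col 0 = col 2 \<and> col 3 = col 4"
    then show ?thesis by (intro exI[of _ 2]) (auto simp: p5 refl_mod_def dest!: l)
  next
    assume "col 0 = col 3 \<and> col 1 = col 2"
    then show ?thesis by (intro exI[of _ 3]) (auto simp: p5 refl_mod_def dest!: l)
  next
    assume "col 0 = col 4 \<and> col 1 = col 3"
    then show ?thesis by (intro exI[of _ 4]) (auto simp: p5 refl_mod_def dest!: l)
  qed
qed

lemma snd_direct_sum_eq: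
  "snd (direct_sum (parallel_product (cyclic_regular p) r) (trivial_grp q)) = layers p r <+> {..<q}"
  by (simp add: direct_sum_def parallel_product_cyclic_eq trivial_grp_def)

text \<open>With a single layer the condition \<open>cross\<close> is vacuous, so the reflection
  survives whatever the number of colours.\<close>

lemma parallel_product_1_notin_GR:
  assumes p: "p \<ge> 3"
  shows "direct_sum (parallel_product (cyclic_regular p) 1) (trivial_grp q) \<notin> GR k"
proof
  assume "direct_sum (parallel_product (cyclic_regular p) 1) (trivial_grp q) \<in> GR k"
  then obtain E where "fst (direct_sum (parallel_product (cyclic_regular p) 1) (trivial_grp q)) =
      Aut (layers p 1 <+> {..<q}) E"
    by (metis GR_iff prod.collapse snd_direct_sum_eq)
  then show False using reflection_not_excluded[OF p, of 1] by force
qed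

text \<open>The edges from \<open>(0, 1)\<close> to the second layer two-colour the residues, and
  the symmetry of that colouring supplies the condition \<open>cross\<close>.\<close>

lemma parallel_product_2_notin_GR_2:
  assumes p: "p = 3 \<or> p = 5"
  shows "direct_sum (parallel_product (cyclic_regular p) 2) (trivial_grp q) \<notin> GR 2"
proof
  assume "direct_sum (parallel_product (cyclic_regular p) 2) (trivial_grp q) \<in> GR 2"
  then obtain E where E: "colored_graph 2 (layers p 2 <+> {..<q}) E"
    and A: "fst (direct_sum (parallel_product (cyclic_regular p) 2) (trivial_grp q)) =
      Aut (layers p 2 <+> {..<q}) E"
    by (metis GR_iff prod.collapse snd_direct_sum_eq)
  have "E {Inl (0, 1), Inl (d, 2)} < 2" if "d < p" for d
  proof -
    have "Inl (0, 1) \<in> layers p 2 <+> {..<q}" "Inl (d, 2) \<in> layers p 2 <+> {..<q}" using that by auto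
    moreover have "(Inl (0, 1) :: (nat \<times> nat) + nat) \<noteq> Inl (d, 2)" by simp
    ultimately show ?thesis using E unfolding colored_graph_iff by blast
  qed
  from two_coloring_symmetric[where col = "\<lambda>d. E {Inl (0, 1), Inl (d, 2)}", OF p this]
  obtain c where c: "\<forall>d<p. E {Inl (0, 1), Inl (refl_mod p c d, 2)} = E {Inl (0, 1), Inl (d, 2)}"
    by blast
  show False by (rule reflection_not_excluded[OF _ _ A c]) (use p in auto)
qed

section \<open>Assembling the cases\<close>

lemma GR_if_layers:
  assumes E: "colored_graph k (layers p r) E" "rot p r ` {..<p} = Aut (layers p r) E"
    and k: "k \<ge> 2" and p: "p \<ge> 2" and r: "r \<ge> 1"
  shows "direct_sum (parallel_product (cyclic_regular p) r) (trivial_grp q) \<in> GR k"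
proof -
  have "is_perm_group (parallel_product (cyclic_regular p) r)"
    using p by (intro is_perm_group_parallel_product is_perm_group_cyclic_regular) auto
  moreover have "(rot p r ` {..<p}, layers p r) \<in> GR k" using E by (auto simp: GR_iff)
  ultimately show ?thesis
    unfolding parallel_product_cyclic_eq
    \<comment> \<open>\<open>(0, 1)\<close> and \<open>(1, 1)\<close> serve as the two distinct
      vertices required for adding fixed points.\<close>
    by (rule GR_direct_sum_trivial[OF _ _ k, of _ _ "(0, 1)" "(1, 1)"]) (use p r in auto)
qed

lemma extendable_graph_mono:
  assumes "\<exists>E. extendable_graph p r E" and p: "p > 0" and r: "r \<ge> 1" and le: "r \<le> r'"
  shows "\<exists>E. extendable_graph p r' E"
  using le
proof (induction r' rule: dec_induct)
  case base
  then show ?case using assms by simp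
next
  case (step n)
  then show ?case using extendable_graph_Suc[OF _ p] r by fastforce
qed

theorem theorem3p9:
  fixes p r q :: nat and A :: "'a perm_grp"
  assumes "prime p" and "r \<ge> 1"
    and "is_perm_group A"
    and "perm_iso A (direct_sum (parallel_product (cyclic_regular p) r) (trivial_grp q))"
  shows "(r = 1 \<and> p \<noteq> 2 \<longrightarrow> A \<notin> GR_all) \<and>
    (r = 2 \<and> p \<in> {3, 5} \<longrightarrow> A \<in> GR_star 3) \<and>
    (\<not> (r = 1 \<and> p \<noteq> 2) \<and> \<not> (r = 2 \<and> p \<in> {3, 5}) \<longrightarrow> A \<in> GR 2)"
proof -
  let ?D = "direct_sum (parallel_product (cyclic_regular p) r) (trivial_grp q)"
  have p2: "p \<ge> 2" using assms(1) by (rule prime_ge_2_nat)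
  obtain S V where A: "A = (S, V)" by fastforce
  obtain B W where D: "?D = (B, W)" by fastforce
  have "is_perm_group ?D"
    using p2 by (intro is_perm_group_direct_sum is_perm_group_parallel_product
        is_perm_group_cyclic_regular is_perm_group_trivial_grp) simp
  \<comment> \<open>Invariance under isomorphism, used in both directions, replaces \<open>A\<close>
    by the explicit model \<open>?D\<close>.\<close>
  then have eq: "A \<in> GR k \<longleftrightarrow> ?D \<in> GR k" for k
    using GR_perm_iso[of S V B W k] GR_perm_iso[of B W S V k] perm_iso_sym[of S V B W] assms(3,4)
    unfolding A D by blast
  have "A \<notin> GR_all" if "r = 1" "p \<noteq> 2"
    using parallel_product_1_notin_GR[of p q] p2 that eq by (auto simp: GR_all_def)
  moreover have "A \<in> GR_star 3" if r: "r = 2" and p: "p \<in> {3, 5}"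
  proof -
    have "?D \<notin> GR 2" unfolding r by (rule parallel_product_2_notin_GR_2) (use p in simp)
    moreover obtain E where "colored_graph 3 (layers p 2) E"
      "rot p 2 ` {..<p} = Aut (layers p 2) E"
      using three_colored_parallel_product_2[OF p2] by blast
    then have "?D \<in> GR 3" unfolding r by (rule GR_if_layers) (use p2 in simp_all)
    ultimately show ?thesis by (simp add: GR_star_def eq)
  qed
  moreover have "A \<in> GR 2" if n: "\<not> (r = 1 \<and> p \<noteq> 2)" "\<not> (r = 2 \<and> p \<in> {3, 5})"
  proof -
    have "\<exists>E. extendable_graph p r E"
    proof -
      \<comment> \<open>The cases start from graphs on one, three and two layers respectively; the
        first two are then extended layer by layer.\<close>
      consider "p = 2" | "p \<ge> 3" "r \<ge> 3" | "p \<ge> 3" "r = 2" "p \<noteq> 3" "p \<noteq> 5"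
        using p2 assms(2) n by force
      then show ?thesis
      proof cases
        case 1
        show ?thesis
          by (rule extendable_graph_mono[of _ 1]) (use 1 extendable_graph_prime_2 assms(2) in auto)
      next
        case 2
        show ?thesis
          by (rule extendable_graph_mono[of _ 3]) (use 2 extendable_graph_3 in auto)
      next
        case 3
        \<comment> \<open>Excluding 4 and 6 leaves only primes from 7 on, as the two-layer graph
          requires.\<close>
        have "\<not> prime (4 :: nat)" "\<not> prime (6 :: nat)"
          using prime_product[of 2 2] prime_product[of 2 3] by auto
        then have "p \<noteq> 4" "p \<noteq> 6" using assms(1) by metis+
        then have "p \<ge> 7" using 3 by linarith
        then show ?thesis unfolding 3(2) by (rule extendable_graph_2)
      qed
    qed
    then obtain E where "colored_graph 2 (layers p r) E" "rot p r ` {..<p} = Aut (layers p r) E"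
      by (auto simp: extendable_graph_def)
    then have "?D \<in> GR 2" by (rule GR_if_layers) (use p2 assms(2) in simp_all)
    then show ?thesis by (simp add: eq)
  qed
  ultimately show ?thesis by blast
qed

end
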